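(* Let the transmitters form a Neyman-Scott cluster process $\phi$ on $\mathbb{R}^2$ with parent intensity $\lambda_p$, a Poisson number of points per cluster with mean $\bar c$, and isotropic scattering density $f$; assume Rayleigh fading and no noise. Let $T>0$ and let the receiver be at $z$ with $\|z\|=R>0$. Let $\lambda=\lambda_p\bar c$ and $\hat f^{*}=\sup_{y\in\mathbb{R}^2}(f*f)(y)$. Then $$\mathbb{P}(\text{success})\ \ge\ P_p(\lambda)\,P_p(\bar c\,\hat f^{*}),$$ where $P_p(x)$ denotes the success probability (same $R$, $T$, $g$, fading) when $\phi$ is a Poisson point process of intensity $x$.
   Context: Neyman-Scott cluster process: the parents form a stationary Poisson point process on $\mathbb{R}^2$ of intensity $\lambda_p>0$; to each parent $x$ is attached an independent cluster with a Poisson number (mean $\bar c>0$) of points located at $x$ plus i.i.d. displacements with isotropic probability density $f$; $\phi$ is the union of all clusters (parents not included). $\mathbb{P}(\text{success})=\mathbb{P}^{!0}\big(h\,g(z)/I_\phi(z)\ge T\big)$, where $I_\phi(z)=\sum_{x\in\phi}h_xg(x-z)$, $h$ and the $h_x$ are i.i.d. exponential random variables independent of $\phi$, and $\mathbb{P}^{!0}$ is the probability under the reduced Palm distribution of $\phi$ at the origin (conditioning on a point of $\phi$ at the origin and removing it). It depends on $z$ only through $R=\|z\|$. For a Poisson point process of intensity $x$ the success probability is $P_p(x)=\exp\big(-x\int_{\mathbb{R}^2}\frac{g(y)}{g(R)/T+g(y)}\,dy\big)$, with $P_p(\infty)=0$; $g(R)$ denotes the value of $g$ at any point of norm $R$.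 The path-loss function $g:\mathbb{R}^2\setminus\{o\}\to\mathbb{R}^+$ is a continuous, positive, non-increasing function of $\|x\|$, with $\int_{\mathbb{R}^2\setminus B(o,\epsilon)}g(x)\,dx<\infty$ for all $\epsilon>0$, and $\lim_{\|x\|\to\infty}g(x)/g(x-y)=1$ for all $y\in\mathbb{R}^2$. *)

theory Defs
  imports "HOL-Probability.Probability"
begin

section \<open>Point processes in the plane\<close>

type_synonym plane = "real ^ 2"

definition locally_finite :: "plane set \<Rightarrow> bool" where
  "locally_finite \<psi> \<longleftrightarrow> (\<forall>B. bounded B \<longrightarrow> finite (\<psi> \<inter> B))"

text \<open>The sigma-algebra on locally finite configurations is the one generated by the counts
  \<open>\<psi> \<mapsto> card (\<psi> \<inter> B)\<close> for bounded Borel sets \<open>B\<close>.\<close>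

definition configurations :: "plane set measure" where
  "configurations = sigma {\<psi>. locally_finite \<psi>}
     {{\<psi>. locally_finite \<psi> \<and> card (\<psi> \<inter> B) = n} | B n. B \<in> sets borel \<and> bounded B}"

text \<open>A stationary Poisson process is given by an enumeration \<open>X\<close> of its (almost surely infinitely
  many) points. Since \<open>card\<close> of an infinite set is \<open>0\<close>, local finiteness is required separately.
  The Poisson probabilities are written out because \<open>poisson_pmf\<close> is unspecified at rate \<open>0\<close>,
  which occurs for null sets \<open>B\<close>. Independence of the infinite family of counts of disjoint sets
  means independence of all its finite subfamilies.\<close>

definition stationary_poisson_process ::
    "'w measure \<Rightarrow> real \<Rightarrow> (nat \<Rightarrow> 'w \<Rightarrow> plane) \<Rightarrow> bool" where
  "stationary_poisson_process M l X \<longleftrightarrow>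
     (\<forall>i. X i \<in> borel_measurable M) \<and>
     (AE \<omega> in M. \<forall>B. bounded B \<longrightarrow> finite {i. X i \<omega> \<in> B}) \<and>
     (\<forall>B n. B \<in> sets borel \<longrightarrow> bounded B \<longrightarrow>
        \<P>(\<omega> in M. card {i. X i \<omega> \<in> B} = n)
          = (l * measure lborel B) ^ n / fact n * exp (- (l * measure lborel B))) \<and>
     (\<forall>B. disjoint_family B \<longrightarrow> (\<forall>k::nat. B k \<in> sets borel \<and> bounded (B k)) \<longrightarrow>
        prob_space.indep_vars M (\<lambda>_. count_space UNIV) (\<lambda>k \<omega>. card {i. X i \<omega> \<in> B k}) UNIV)"

definition isotropic_density :: "(plane \<Rightarrow> real) \<Rightarrow> bool" where
  "isotropic_density f \<longleftrightarrow>
     f \<in> borel_measurable borel \<and> (\<forall>x. f x \<ge> 0) \<and> (\<integral>\<^sup>+x. ennreal (f x) \<partial>lborel) = 1 \<and>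
     (\<forall>x y. norm x = norm y \<longrightarrow> f x = f y)"

text \<open>A cluster is encoded as \<open>(n, d)\<close>: its size and a sequence of i.i.d. displacements, of which
  only the first \<open>n\<close> are used.\<close>

definition cluster_law :: "real \<Rightarrow> (plane \<Rightarrow> real) \<Rightarrow> (nat \<times> (nat \<Rightarrow> plane)) measure" where
  "cluster_law c f =
     measure_pmf (poisson_pmf c) \<Otimes>\<^sub>M (\<Pi>\<^sub>M j\<in>UNIV. density lborel (\<lambda>x. ennreal (f x)))"

text \<open>The equation of joint laws says that the clusters \<open>K i\<close> are i.i.d. with law \<open>cluster_law c f\<close>
  and that the sequence of clusters is independent of the sequence of parents. (\<open>indep_var\<close> needs
  both variables to take values in the same type.)\<close>

definition neyman_scott_process ::
    "'w measure \<Rightarrow> real \<Rightarrow> real \<Rightarrow> (plane \<Rightarrow> real) \<Rightarrow> ('w \<Rightarrow> plane set) \<Rightarrow> bool" where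
  "neyman_scott_process M l c f \<phi> \<longleftrightarrow>
     (\<exists>X K. stationary_poisson_process M l X \<and>
        (\<forall>i. K i \<in> measurable M (cluster_law c f)) \<and>
        distr M ((\<Pi>\<^sub>M i\<in>UNIV. borel) \<Otimes>\<^sub>M (\<Pi>\<^sub>M i\<in>UNIV. cluster_law c f))
            (\<lambda>\<omega>. (\<lambda>i. X i \<omega>, \<lambda>i. K i \<omega>))
          = distr M (\<Pi>\<^sub>M i\<in>UNIV. borel) (\<lambda>\<omega> i. X i \<omega>) \<Otimes>\<^sub>M (\<Pi>\<^sub>M i\<in>UNIV. cluster_law c f) \<and>
        (\<forall>\<omega>\<in>space M. \<phi> \<omega> = (\<Union>i::nat. {X i \<omega> + snd (K i \<omega>) j | j. j < fst (K i \<omega>)})))"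

text \<open>Reduced Palm distribution at the origin of a stationary point process \<open>\<phi>\<close>:
  \<open>E [\<Sum>x\<in>\<phi> \<inter> W. 1 ((\<phi> - x) - {0} \<in> A)] / E [card (\<phi> \<inter> W)]\<close>. By stationarity every
  bounded Borel window \<open>W\<close> of positive area gives the same value; \<open>W\<close> is the unit square, so that the
  denominator is the intensity of \<open>\<phi>\<close>. The sums over points are integrals with respect to counting
  measure.\<close>

definition reduced_palm :: "'w measure \<Rightarrow> ('w \<Rightarrow> plane set) \<Rightarrow> plane set measure" where
  "reduced_palm M \<phi> = measure_of (space configurations) (sets configurations)
     (\<lambda>A. (\<integral>\<^sup>+\<omega>. (\<integral>\<^sup>+x. indicator A ((\<lambda>y. y - x) ` (\<phi> \<omega> - {x}))
                    \<partial>count_space (\<phi> \<omega> \<inter> cbox 0 One)) \<partial>M)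
        / (\<integral>\<^sup>+\<omega>. emeasure (count_space UNIV) (\<phi> \<omega> \<inter> cbox 0 One) \<partial>M))"


section \<open>Success probability under Rayleigh fading\<close>

text \<open>The value of \<open>g\<close> at the origin is irrelevant. Monotonicity makes \<open>g\<close> a function of the norm.\<close>

definition path_loss :: "(plane \<Rightarrow> real) \<Rightarrow> bool" where
  "path_loss g \<longleftrightarrow>
     continuous_on (- {0}) g \<and> (\<forall>x. x \<noteq> 0 \<longrightarrow> g x > 0) \<and>
     (\<forall>x y. x \<noteq> 0 \<longrightarrow> norm x \<le> norm y \<longrightarrow> g y \<le> g x) \<and>
     (\<forall>\<epsilon>>0. set_integrable lborel (- ball 0 \<epsilon>) g) \<and>
     (\<forall>y. ((\<lambda>x. g x / g (x - y)) \<longlongrightarrow> 1) at_infinity)"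

text \<open>Here \<open>hs x\<close> is the fading of the transmitter at \<open>x\<close>. The value may be infinite.\<close>

definition interference ::
    "(plane \<Rightarrow> real) \<Rightarrow> plane \<Rightarrow> plane set \<Rightarrow> (plane \<Rightarrow> real) \<Rightarrow> ennreal" where
  "interference g z \<psi> hs = (\<integral>\<^sup>+x. ennreal (hs x * g (x - z)) \<partial>count_space \<psi>)"

definition fading_law :: "real \<Rightarrow> real measure" where
  "fading_law \<mu> = density lborel (\<lambda>x. ennreal (exponential_density \<mu> x))"

text \<open>Success probability given the configuration \<open>\<psi>\<close> of interferers; the desired transmitter is at
  the origin. In \<open>ennreal\<close>, \<open>a / 0 = \<top>\<close> for \<open>a > 0\<close> and \<open>a / \<top> = 0\<close> for finite \<open>a\<close>.\<close>

definition success_given ::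
    "real \<Rightarrow> (plane \<Rightarrow> real) \<Rightarrow> real \<Rightarrow> plane \<Rightarrow> plane set \<Rightarrow> real" where
  "success_given \<mu> g T z \<psi> =
     \<P>((h, hs) in fading_law \<mu> \<Otimes>\<^sub>M (\<Pi>\<^sub>M x\<in>\<psi>. fading_law \<mu>).
        ennreal (h * g z) / interference g z \<psi> hs \<ge> ennreal T)"

text \<open>As the fading is independent of the point process, the success probability is the mean of the
  conditional one under the reduced Palm distribution.\<close>

definition success_prob ::
    "'w measure \<Rightarrow> ('w \<Rightarrow> plane set) \<Rightarrow> real \<Rightarrow> (plane \<Rightarrow> real) \<Rightarrow> real \<Rightarrow> plane \<Rightarrow> real" where
  "success_prob M \<phi> \<mu> g T z = (\<integral>\<psi>. success_given \<mu> g T z \<psi> \<partial>reduced_palm M \<phi>)"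

text \<open>Success probability for a Poisson process of intensity \<open>x\<close>; the value at \<open>x = \<infinity>\<close> is \<open>0\<close>.\<close>

definition poisson_success :: "(plane \<Rightarrow> real) \<Rightarrow> real \<Rightarrow> plane \<Rightarrow> ennreal \<Rightarrow> real" where
  "poisson_success g T z x =
     (if x = \<infinity> then 0
      else exp (- enn2real x * (\<integral>y. g y / (g z / T + g y) \<partial>lborel)))"

text \<open>The pointwise convolution of two nonnegative functions, possibly infinite.\<close>

definition fun_convolution :: "(plane \<Rightarrow> real) \<Rightarrow> (plane \<Rightarrow> real) \<Rightarrow> plane \<Rightarrow> ennreal" where
  "fun_convolution f k y = (\<integral>\<^sup>+x. ennreal (f x) * ennreal (k (y - x)) \<partial>lborel)"

end

theory Submission
  imports Defs
begin

text \<open>Write \<open>\<sigma>(x) = ln (1 + T g(x - z) / g(z))\<close>. Integrating out the fading, the success probability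
  given the interferers \<open>\<psi>\<close> is \<open>exp (- \<Sum>x\<in>\<psi>. \<sigma>(x))\<close>. Put \<open>w = 1 - exp (- \<sigma>)\<close>, which is the integrand
  of \<open>P\<^sub>p\<close> translated by \<open>z\<close>, and \<open>b(x) = c \<integral> w(x + d) f(d) dd\<close>, so that \<open>exp (- b(x))\<close> is the mean over
  one cluster with parent \<open>x\<close>. The Mecke formula for the parents and its analogue for a Poisson
  cluster turn the Palm expectation into
  \<open>exp (- \<lambda>\<^sub>p \<integral> (1 - exp (- b))) * \<integral> exp (- b(- d)) f(d) dd\<close>.
  The first factor is at least \<open>P\<^sub>p(\<lambda>\<^sub>p c)\<close> because \<open>1 - exp (- b) \<le> b\<close>. By Jensen's inequality the
  second one is at least \<open>exp (- \<integral> b(- d) f(d) dd)\<close>, and the integral equals \<open>c \<integral> w (f * f)\<close> as \<open>f\<close>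
  is even.\<close>

text \<open>The product form rests on a feature of Poisson clusters. A point y taken from the
  cluster with parent x leaves behind a Poisson cluster with the same parent, because a size-biased
  Poisson number minus one is again Poisson. Hence the remainder of its own cluster contributes exp
  (- b(x - y)), the same factor as any other cluster. The product over the parents is then complete,
  and the Mecke formula for the parents applies to it with weight f(y - x).

  Two gaps separate this computation from the Palm distribution. The latter sums over a set of
  points, the former over labels (parent, number in the cluster), and two labels might carry the
  same point; the labelled formula itself, for another choice of \<sigma>, shows that almost surely
  this does not happen. Moreover, \<open>measure_of\<close> gives the intended measure only for a
  countably additive set function, so the Palm distribution is identified with an image measure
  built for the purpose.\<close>

section \<open>The function exp (-x) on [0, \<infinity>]\<close>

text \<open>The argument ranges over [0, \<infinity>] because sums over infinitely many points may
  diverge. With the value 0 at \<top> the functional equation and monotone limits hold without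
  convergence hypotheses.\<close>

definition expneg :: "ennreal \<Rightarrow> ennreal" where
  "expneg x = (if x = \<top> then 0 else ennreal (exp (- enn2real x)))"

lemma expneg_top [simp]: "expneg \<top> = 0"
  by (simp add: expneg_def)

lemma expneg_ennreal [simp]: "0 \<le> r \<Longrightarrow> expneg (ennreal r) = ennreal (exp (- r))"
  by (simp add: expneg_def)

lemma expneg_0 [simp]: "expneg 0 = 1"
  by (simp add: expneg_def)

lemma measurable_expneg [measurable]: "expneg \<in> borel_measurable borel"
  unfolding expneg_def by measurable

lemma expneg_add: "expneg (a + b) = expneg a * expneg b"
  by (cases a; cases b) (auto simp: mult_exp_exp simp flip: ennreal_plus ennreal_mult)

lemma expneg_sum: "finite I \<Longrightarrow> expneg (\<Sum>i\<in>I. f i) = (\<Prod>i\<in>I. expneg (f i))"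
  by (induction I rule: finite_induct) (auto simp: expneg_add)

lemma expneg_le_1 [simp]: "expneg a \<le> 1"
  by (cases a) auto

lemma expneg_neq_top [simp]: "expneg a \<noteq> \<top>"
  by (cases a) auto

lemma expneg_antimono: "a \<le> b \<Longrightarrow> expneg b \<le> expneg a"
  by (cases a; cases b) (auto simp: top_unique)

lemma expneg_ge_iff:
  assumes "0 < r" "r \<le> 1"
  shows "ennreal r \<le> expneg x \<longleftrightarrow> x \<le> ennreal (- ln r)"
proof (cases x)
  case (real y)
  have "r \<le> exp (- y) \<longleftrightarrow> y \<le> - ln r"
    using assms exp_le_cancel_iff[of "ln r" "- y"] by auto
  then show ?thesis using real assms by auto
qed (use assms in \<open>auto simp: top_unique\<close>)

text \<open>By \<open>expneg_ge_iff\<close>, a positive lower bound r of all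
  \<open>expneg (F i)\<close> is the same as an upper bound - ln r of all \<open>F i\<close>, hence
  of their supremum. For empty \<open>I\<close> the left side would be 1 and the right side
  \<top>.\<close>

lemma expneg_SUP:
  assumes "I \<noteq> {}"
  shows "expneg (SUP i\<in>I. F i) = (INF i\<in>I. expneg (F i))"
proof (rule antisym)
  show "expneg (SUP i\<in>I. F i) \<le> (INF i\<in>I. expneg (F i))"
    by (auto intro!: INF_greatest expneg_antimono SUP_upper)
  obtain i0 where "i0 \<in> I" using assms by auto
  then have le1: "(INF i\<in>I. expneg (F i)) \<le> 1"
    by (meson INF_lower2 expneg_le_1)
  show "(INF i\<in>I. expneg (F i)) \<le> expneg (SUP i\<in>I. F i)"
  proof (cases "(INF i\<in>I. expneg (F i))")
    case (real r)
    show ?thesis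
    proof (cases "r = 0")
      case False
      then have r: "0 < r" "r \<le> 1" using real le1 by auto
      have "F i \<le> ennreal (- ln r)" if "i \<in> I" for i
        using expneg_ge_iff[OF r] real(2) INF_lower[OF that, of "\<lambda>i. expneg (F i)"] by simp
      then show ?thesis unfolding real(2)
        by (subst expneg_ge_iff[OF r]) (auto intro: SUP_least)
    qed (use real in simp)
  qed (use le1 in \<open>auto simp: top_unique\<close>)
qed

section \<open>Monotone difference quotients of the exponential\<close>

lemma one_minus_expneg_le: "1 - expneg a \<le> a"
proof (cases a)
  case (real r)
  have "1 - exp (-r) \<le> r"
    using exp_ge_add_one_self[of "-r"] by simp
  with real show ?thesis
    by (simp add: ennreal_leI ennreal_minus flip: ennreal_1)
qed auto

text \<open>With u = a / x the derivative of x (1 - exp (- a / x)) is 1 - (1 + u) exp (- u), which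
  is nonnegative because 1 + u \<le> exp u.\<close>

lemma scaled_one_minus_exp_mono:
  assumes "0 \<le> a" "0 < s" "s \<le> t"
  shows "s * (1 - exp (- (a / s))) \<le> t * (1 - exp (- (a / t :: real)))"
proof -
  have d: "\<forall>x>0. ((\<lambda>x. x * (1 - exp (- (a / x)))) has_real_derivative
      (1 - exp (- (a / x)) - (a / x) * exp (- (a / x)))) (at x)"
    by (auto intro!: derivative_eq_intros simp: field_simps power2_eq_square)
  show ?thesis
  proof (rule DERIV_nonneg_imp_nondecreasing[OF assms(3)], intro exI conjI)
    fix x assume "s \<le> x" "x \<le> t"
    then have "x > 0" using assms by auto
    show "((\<lambda>x. x * (1 - exp (- (a / x)))) has_real_derivative
      (1 - exp (- (a / x)) - (a / x) * exp (- (a / x)))) (at x)"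
      using d \<open>x > 0\<close> by blast
    have "(1 + a / x) * exp (- (a / x)) \<le> exp (a/x) * exp (- (a / x))"
      by (intro mult_right_mono) auto
    then show "0 \<le> 1 - exp (- (a / x)) - (a / x) * exp (- (a / x))"
      by (simp add: exp_minus algebra_simps)
  qed
qed

text \<open>The difference quotient of - exp (- a t) between t = 0 and t = 1 / (n + 1). It increases
  to a, even for a = \<top>, so that monotone convergence can stand in for differentiation under the
  integral.\<close>

definition expneg_quot :: "nat \<Rightarrow> ennreal \<Rightarrow> ennreal" where
  "expneg_quot n a = of_nat (Suc n) * (1 - expneg (a / of_nat (Suc n)))"

lemma measurable_expneg_quot [measurable]: "expneg_quot n \<in> borel_measurable borel"
  unfolding expneg_quot_def by measurable

lemma expneg_quot_ennreal:
  "0 \<le> a \<Longrightarrow> expneg_quot n (ennreal a) = ennreal (real (Suc n) * (1 - exp (- (a / real (Suc n)))))"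
  unfolding expneg_quot_def
  by (subst divide_ennreal[symmetric, of a "real (Suc n)"] | 
      simp add: ennreal_minus ennreal_mult divide_ennreal ennreal_of_nat_eq_real_of_nat del: of_nat_Suc flip: ennreal_1)+

lemma expneg_quot_top: "expneg_quot n \<top> = of_nat (Suc n)"
  by (simp add: expneg_quot_def ennreal_top_divide del: of_nat_Suc)

lemma expneg_quot_le: "expneg_quot n a \<le> a"
proof -
  have "expneg_quot n a \<le> of_nat (Suc n) * (a / of_nat (Suc n))"
    unfolding expneg_quot_def by (intro mult_left_mono one_minus_expneg_le) auto
  also have "\<dots> = a" 
    by (simp add: ennreal_times_divide mult.commute[of "of_nat (Suc n)"] mult_divide_eq_ennreal del: of_nat_Suc)
  finally show ?thesis .
qed

lemma expneg_quot_mono: "a \<le> b \<Longrightarrow> expneg_quot n a \<le> expneg_quot n b"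
  unfolding expneg_quot_def
  by (intro mult_left_mono ennreal_minus_mono expneg_antimono divide_right_mono_ennreal order_refl) auto

lemma incseq_expneg_quot: "incseq (\<lambda>n. expneg_quot n a)"
proof (cases a)
  case (real r)
  show ?thesis unfolding real incseq_def
    using real scaled_one_minus_exp_mono[of r] by (auto simp: expneg_quot_ennreal simp del: of_nat_Suc intro!: ennreal_leI)
next
  case top
  then show ?thesis by (auto simp: expneg_quot_top incseq_def simp del: of_nat_Suc intro!: of_nat_mono)
qed

lemma SUP_expneg_quot: "(SUP n. expneg_quot n a) = a"
proof (cases a)
  case (real r)
  have "((\<lambda>h. (exp (0 + h) - exp 0) / h) \<longlongrightarrow> exp 0) (at (0::real))"
    using DERIV_exp[of "0::real"] unfolding DERIV_def .
  show ?thesis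
  proof (cases "r = 0")
    case True then show ?thesis using real by (simp add: expneg_quot_def)
  next
    case False
    then have r: "r > 0" using real by auto
    \<comment> \<open>The increments - r / (n + 1) approach 0 without reaching it, as the punctured
      filter of the derivative of exp at 0 demands; this is why r = 0 was split off.\<close>
    have "filterlim (\<lambda>n. - (r / real (Suc n))) (at 0) sequentially"
    proof (rule filterlim_atI)
      have "(\<lambda>n. r * inverse (real (Suc n))) \<longlonglongrightarrow> r * 0"
        by (intro tendsto_intros LIMSEQ_inverse_real_of_nat)
      then show "(\<lambda>n. - (r / real (Suc n))) \<longlonglongrightarrow> 0"
        using tendsto_minus by (fastforce simp: divide_inverse)
    qed (use r in auto)
    from filterlim_compose[OF \<open>((\<lambda>h. (exp (0 + h) - exp 0) / h) \<longlongrightarrow> exp 0) (at (0::real))\<close> this]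
    have "(\<lambda>n. r * ((exp (- (r / real (Suc n))) - 1) / (- (r / real (Suc n))))) \<longlonglongrightarrow> r * 1"
      by (intro tendsto_intros) simp
    also have "(\<lambda>n. r * ((exp (- (r / real (Suc n))) - 1) / (- (r / real (Suc n))))) = 
       (\<lambda>n. real (Suc n) * (1 - exp (- (r / real (Suc n)))))"
      using r by (auto simp: field_simps)
    finally have "(\<lambda>n. expneg_quot n a) \<longlonglongrightarrow> a"
      using real by (auto simp: expneg_quot_ennreal simp del: of_nat_Suc)
    then show ?thesis
      using LIMSEQ_SUP[OF incseq_expneg_quot[of a]] LIMSEQ_unique by blast
  qed
next
  case top
  have "(SUP n. of_nat n) \<le> (SUP n. of_nat (Suc n) :: ennreal)"
    by (intro SUP_mono') (auto intro: of_nat_mono)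
  then have "(SUP n. of_nat (Suc n)) = (\<top>::ennreal)"
    by (simp add: ennreal_SUP_of_nat_eq_top top_unique del: of_nat_Suc)
  then show ?thesis using top by (simp add: expneg_quot_top del: of_nat_Suc)
qed

text \<open>Decreasing monotone convergence needs one finite integral. The integrands are at most 1
  and the measure is finite.\<close>

lemma nn_integral_expneg_SUP:
  assumes "finite_measure M" "incseq F" and [measurable]: "\<And>n. F n \<in> borel_measurable M"
  shows "(\<integral>\<^sup>+x. expneg (SUP n. F n x) \<partial>M) = (INF n. \<integral>\<^sup>+x. expneg (F n x) \<partial>M)"
proof -
  interpret finite_measure M by fact
  have "(\<integral>\<^sup>+x. expneg (F 0 x) \<partial>M) \<le> (\<integral>\<^sup>+x. 1 \<partial>M)"
    by (intro nn_integral_mono) auto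
  also have "\<dots> < \<top>" by (simp add: less_top[symmetric])
  finally have "(\<integral>\<^sup>+x. expneg (F 0 x) \<partial>M) < \<infinity>" by simp
  then show ?thesis
    using assms(2) by (subst nn_integral_monotone_convergence_INF_decseq[symmetric, where i=0])
      (auto simp: expneg_SUP monotone_on_def le_fun_def intro!: expneg_antimono)
qed

section \<open>Product spaces\<close>

lemma finite_to_nat_on_less: "countable I \<Longrightarrow> finite {i\<in>I. to_nat_on I i < n}"
  using inj_on_to_nat_on[of I]
  by (intro inj_on_finite[of "to_nat_on I" _ "{..<n}"]) (auto simp: inj_on_def)

text \<open>The initial segments of an enumeration are finite and exhaust \<open>I\<close> whether
  it is finite or infinite, so configurations of interferers of either kind are covered at
  once.\<close>

lemma nn_integral_count_space_SUP:
  fixes f :: "'i \<Rightarrow> ennreal"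
  assumes "countable I"
  shows "(\<integral>\<^sup>+i. f i \<partial>count_space I) = (SUP n. \<Sum>i\<in>{i\<in>I. to_nat_on I i < n}. f i)"
proof -
  have "(\<integral>\<^sup>+i. f i \<partial>count_space I)
      = (\<integral>\<^sup>+i. (SUP n. f i * indicator {i\<in>I. to_nat_on I i < n} i) \<partial>count_space I)"
  proof (intro nn_integral_cong)
    fix i assume "i \<in> space (count_space I)"
    then show "f i = (SUP n. f i * indicator {i\<in>I. to_nat_on I i < n} i)"
      by (intro antisym SUP_upper2[of "Suc (to_nat_on I i)"] SUP_least) (auto simp: indicator_def)
  qed
  also have "\<dots> = (SUP n. \<integral>\<^sup>+i. f i * indicator {i\<in>I. to_nat_on I i < n} i \<partial>count_space I)"
    by (intro nn_integral_monotone_convergence_SUP) (auto simp: incseq_def le_fun_def indicator_def)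
  also have "\<dots> = (SUP n. \<Sum>i\<in>{i\<in>I. to_nat_on I i < n}. f i)"
    by (intro SUP_cong refl, subst nn_integral_count_space'[of "{i\<in>I. to_nat_on I i < _}"])
       (auto simp: finite_to_nat_on_less assms intro!: sum.cong)
  finally show ?thesis .
qed

lemma borel_measurable_nn_integral_count_space:
  fixes f :: "'i \<Rightarrow> 'a \<Rightarrow> ennreal"
  assumes "countable I" "\<And>i. i \<in> I \<Longrightarrow> f i \<in> borel_measurable M"
  shows "(\<lambda>x. \<integral>\<^sup>+i. f i x \<partial>count_space I) \<in> borel_measurable M"
  unfolding nn_integral_count_space_SUP[OF assms(1)]
  using assms(2) by (intro borel_measurable_SUP borel_measurable_sum) auto

lemma nn_integral_PiM_prod:
  assumes "\<And>i. i \<in> I \<Longrightarrow> prob_space (M i)" "finite J" "J \<subseteq> I"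
    and "\<And>i. i \<in> J \<Longrightarrow> f i \<in> borel_measurable (M i)"
  shows "(\<integral>\<^sup>+\<omega>. (\<Prod>i\<in>J. f i (\<omega> i)) \<partial>PiM I M) = (\<Prod>i\<in>J. \<integral>\<^sup>+x. f i x \<partial>M i :: ennreal)"
proof -
  \<comment> \<open>The locale \<open>product_prob_space\<close> asks for a probability measure at
    every index. Outside \<open>I\<close>, where nothing is assumed of \<open>M\<close>, a point
    mass is put in its place.\<close>
  define N where "N i = (if i \<in> I then M i else return (count_space UNIV) undefined)" for i
  have N: "prob_space (N i)" for i
    using assms(1) by (auto simp: N_def intro!: prob_space_return)
  interpret product_prob_space N I
    by (intro product_prob_spaceI N)
  have PM: "PiM I M = PiM I N"
    by (intro PiM_cong) (auto simp: N_def)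
  have NJ: "N i = M i" if "i \<in> J" for i
    using that assms(3) by (auto simp: N_def)
  have "(\<integral>\<^sup>+\<omega>. (\<Prod>i\<in>J. f i (\<omega> i)) \<partial>PiM I N) = (\<integral>\<^sup>+\<omega>. (\<Prod>i\<in>J. f i (restrict \<omega> J i)) \<partial>PiM I N)"
    by (intro nn_integral_cong prod.cong) auto
  also have "\<dots> = (\<integral>\<^sup>+\<omega>. (\<Prod>i\<in>J. f i (\<omega> i)) \<partial>distr (PiM I N) (PiM J N) (\<lambda>x. restrict x J))"
    using assms(4) NJ
    by (subst nn_integral_distr) (auto intro!: measurable_restrict_subset assms borel_measurable_prod_ennreal
       measurable_compose[OF measurable_component_singleton])
  also have "distr (PiM I N) (PiM J N) (\<lambda>x. restrict x J) = PiM J N"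
    using assms by (intro distr_PiM_restrict_finite) auto
  also have "(\<integral>\<^sup>+\<omega>. (\<Prod>i\<in>J. f i (\<omega> i)) \<partial>PiM J N) = (\<Prod>i\<in>J. \<integral>\<^sup>+x. f i x \<partial>N i)"
    using assms NJ by (intro product_nn_integral_prod) auto
  finally show ?thesis
    by (simp add: PM NJ)
qed

text \<open>Finite partial sums factorise by independence, and both sides pass to the limit along
  finite initial segments. Here \<open>a i\<close> is minus the logarithm of the Laplace transform
  of \<open>S i\<close>. It serves both for the fadings of a fixed configuration and for the
  clusters of all parents.\<close>

lemma nn_integral_PiM_expneg:
  assumes I: "countable I" and M: "\<And>i. i \<in> I \<Longrightarrow> prob_space (M i)"
    and S: "\<And>i. i \<in> I \<Longrightarrow> S i \<in> borel_measurable (M i)"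
    and a: "\<And>i. i \<in> I \<Longrightarrow> (\<integral>\<^sup>+x. expneg (S i x) \<partial>M i) = expneg (a i)"
  shows "(\<integral>\<^sup>+\<omega>. expneg (\<integral>\<^sup>+i. S i (\<omega> i) \<partial>count_space I) \<partial>PiM I M)
    = expneg (\<integral>\<^sup>+i. a i \<partial>count_space I)"
proof -
  define J where "J n = {i\<in>I. to_nat_on I i < n}" for n
  have J: "finite (J n)" "J n \<subseteq> I" for n
    using finite_to_nat_on_less[OF I] by (auto simp: J_def)
  interpret P: prob_space "PiM I M" using M by (rule prob_space_PiM)
  have "(\<integral>\<^sup>+\<omega>. expneg (\<integral>\<^sup>+i. S i (\<omega> i) \<partial>count_space I) \<partial>PiM I M)
      = (\<integral>\<^sup>+\<omega>. expneg (SUP n. \<Sum>i\<in>J n. S i (\<omega> i)) \<partial>PiM I M)"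
    by (simp add: nn_integral_count_space_SUP[OF I] J_def)
  also have "\<dots> = (INF n. \<integral>\<^sup>+\<omega>. expneg (\<Sum>i\<in>J n. S i (\<omega> i)) \<partial>PiM I M)"
  proof (rule nn_integral_expneg_SUP)
    show "incseq (\<lambda>n \<omega>. \<Sum>i\<in>J n. S i (\<omega> i))"
      using J by (auto simp: incseq_def le_fun_def J_def intro!: sum_mono2)
    show "(\<lambda>\<omega>. \<Sum>i\<in>J n. S i (\<omega> i)) \<in> borel_measurable (PiM I M)" for n
      using J S by (auto intro!: borel_measurable_sum measurable_compose[OF measurable_component_singleton])
  qed unfold_locales
  also have "\<dots> = (INF n. \<Prod>i\<in>J n. expneg (a i))"
  proof (intro INF_cong refl)
    fix n
    have "(\<integral>\<^sup>+\<omega>. expneg (\<Sum>i\<in>J n. S i (\<omega> i)) \<partial>PiM I M)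
        = (\<integral>\<^sup>+\<omega>. (\<Prod>i\<in>J n. expneg (S i (\<omega> i))) \<partial>PiM I M)"
      by (simp add: expneg_sum J)
    also have "\<dots> = (\<Prod>i\<in>J n. \<integral>\<^sup>+x. expneg (S i x) \<partial>M i)"
      using J M S
      by (intro nn_integral_PiM_prod) (blast intro: measurable_compose[OF S measurable_expneg])+
    also have "\<dots> = (\<Prod>i\<in>J n. expneg (a i))"
      using a J by (intro prod.cong) auto
    finally show "(\<integral>\<^sup>+\<omega>. expneg (\<Sum>i\<in>J n. S i (\<omega> i)) \<partial>PiM I M) = (\<Prod>i\<in>J n. expneg (a i))" .
  qed
  also have "\<dots> = expneg (\<integral>\<^sup>+i. a i \<partial>count_space I)"
    using J by (simp add: nn_integral_count_space_SUP[OF I] expneg_SUP expneg_sum flip: J_def)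
  finally show ?thesis .
qed

text \<open>Overwriting coordinate i by an independent copy does not change the product law. This
  isolates one cluster, or one displacement, as an outer integral without splitting the index
  set.\<close>

lemma nn_integral_PiM_resample:
  assumes M: "\<And>i. i \<in> I \<Longrightarrow> prob_space (M i)" and i: "i \<in> I"
    and F[measurable]: "F \<in> borel_measurable (PiM I M)"
  shows "(\<integral>\<^sup>+\<omega>. F \<omega> \<partial>PiM I M) = (\<integral>\<^sup>+x. (\<integral>\<^sup>+\<omega>. F (fun_upd \<omega> i x) \<partial>PiM I M) \<partial>M i)"
proof -
  interpret P: prob_space "PiM I M" using M by (rule prob_space_PiM)
  have I: "insert i I = I" using i by auto
  have [measurable]: "(\<lambda>(x, X). fun_upd X i x) \<in> M i \<Otimes>\<^sub>M PiM I M \<rightarrow>\<^sub>M PiM I M"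
    using i
    by (subst measurable_split_conv) (auto intro!: measurable_fun_upd[where J=I])
  have "(\<integral>\<^sup>+\<omega>. F \<omega> \<partial>PiM I M)
      = (\<integral>\<^sup>+\<omega>. F \<omega> \<partial>distr (M i \<Otimes>\<^sub>M PiM I M) (PiM I M) (\<lambda>(x, X). fun_upd X i x))"
    using distr_pair_PiM_eq_PiM[of I M i] M i by (simp add: I)
  also have "\<dots> = (\<integral>\<^sup>+p. F ((\<lambda>(x, X). fun_upd X i x) p) \<partial>(M i \<Otimes>\<^sub>M PiM I M))"
    by (rule nn_integral_distr) measurable
  also have "\<dots> = (\<integral>\<^sup>+x. (\<integral>\<^sup>+\<omega>. F (fun_upd \<omega> i x) \<partial>PiM I M) \<partial>M i)"
    by (subst P.nn_integral_fst[symmetric]) auto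
  finally show ?thesis .
qed

section \<open>Poisson processes\<close>

lemma expneg_mult_of_nat: "expneg (h * of_nat n) = expneg h ^ n"
  by (induction n) (auto simp: distrib_left expneg_add)

lemma nn_integral_comp_nat:
  assumes [measurable]: "N \<in> M \<rightarrow>\<^sub>M count_space (UNIV :: nat set)"
  shows "(\<integral>\<^sup>+\<omega>. g (N \<omega>) \<partial>M) = (\<Sum>n. g n * emeasure M {\<omega>\<in>space M. N \<omega> = n})"
proof -
  have "g (N \<omega>) = (\<Sum>n. g n * indicator {\<omega>\<in>space M. N \<omega> = n} \<omega>)" if "\<omega> \<in> space M" for \<omega>
    using that by (subst suminf_finite[of "{N \<omega>}"]) auto
  then have "(\<integral>\<^sup>+\<omega>. g (N \<omega>) \<partial>M) = (\<integral>\<^sup>+\<omega>. (\<Sum>n. g n * indicator {\<omega>\<in>space M. N \<omega> = n} \<omega>) \<partial>M)"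
    by (intro nn_integral_cong) auto
  also have "\<dots> = (\<Sum>n. g n * emeasure M {\<omega>\<in>space M. N \<omega> = n})"
    by (subst nn_integral_suminf) (auto simp: nn_integral_cmult_indicator)
  finally show ?thesis .
qed

text \<open>The exponential series at a p. The weights are explicit so that rate 0, the case of a
  null set, is included.\<close>

lemma poisson_series:
  assumes "0 \<le> a" "0 \<le> p"
  shows "(\<Sum>n. ennreal (p ^ n) * ennreal (a ^ n / fact n * exp (- a))) = ennreal (exp (- (a * (1 - p))))"
proof -
  have "(\<lambda>n. (a * p) ^ n /\<^sub>R fact n * exp (- a)) sums (exp (a * p) * exp (- a))"
    by (intro sums_mult2 exp_converges)
  also have "exp (a * p) * exp (- a) = exp (- (a * (1 - p)))"
    by (simp add: mult_exp_exp algebra_simps)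
  also have "(\<lambda>n. (a * p) ^ n /\<^sub>R fact n * exp (- a)) = (\<lambda>n. p ^ n * (a ^ n / fact n * exp (- a)))"
    by (auto simp: power_mult_distrib field_simps)
  finally have "(\<Sum>n. ennreal (p ^ n * (a ^ n / fact n * exp (- a)))) = ennreal (exp (- (a * (1 - p))))"
    using assms by (intro suminf_ennreal_eq) auto
  then show ?thesis using assms by (simp flip: ennreal_mult)
qed

lemma poisson_expneg:
  assumes "prob_space M" and [measurable]: "N \<in> M \<rightarrow>\<^sub>M count_space (UNIV :: nat set)"
    and "0 \<le> a" "\<And>n. \<P>(\<omega> in M. N \<omega> = n) = a ^ n / fact n * exp (- a)"
  shows "(\<integral>\<^sup>+\<omega>. expneg (h * of_nat (N \<omega>)) \<partial>M) = expneg (ennreal a * (1 - expneg h))"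
proof -
  interpret prob_space M by fact
  obtain p where p: "expneg h = ennreal p" "0 \<le> p" "p \<le> 1"
    using expneg_le_1[of h] by (cases "expneg h") (auto simp: top_unique)
  have "(\<integral>\<^sup>+\<omega>. expneg (h * of_nat (N \<omega>)) \<partial>M) = (\<Sum>n. ennreal (p ^ n) * ennreal (a ^ n / fact n * exp (- a)))"
    using assms(4) p
    by (subst nn_integral_comp_nat) (simp_all add: expneg_mult_of_nat emeasure_eq_measure ennreal_power)
  also have "\<dots> = ennreal (exp (- (a * (1 - p))))"
    using p assms(3) by (rule_tac poisson_series)
  also have "\<dots> = expneg (ennreal a * (1 - expneg h))"
    using p assms(3) by (simp add: ennreal_minus flip: ennreal_1 ennreal_mult)
  finally show ?thesis .
qed

section \<open>Generating functional and Mecke formula of a Poisson process\<close>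

locale poisson_process = prob_space M for M :: "'w measure" +
  fixes l :: real and X :: "nat \<Rightarrow> 'w \<Rightarrow> plane"
  assumes l_nonneg: "0 \<le> l" and poisson: "stationary_poisson_process M l X"
begin

lemma measurable_point [measurable]: "X i \<in> borel_measurable M"
  using poisson by (auto simp: stationary_poisson_process_def)

text \<open>The level sets of the nonzero values of \<open>S\<close> are disjoint, bounded and
  Borel, so their counts are independent Poisson variables by definition of the process. The sum
  over the points is a linear combination of these counts.\<close>

lemma pgfl_simple:
  assumes S: "simple_function borel S" and bdd: "bounded {x. S x \<noteq> 0}"
  shows "(\<integral>\<^sup>+\<omega>. expneg (\<Sum>i. S (X i \<omega>)) \<partial>M) = expneg (ennreal l * (\<integral>\<^sup>+x. 1 - expneg (S x) \<partial>lborel))"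
proof -
  have "finite (range S - {0})" using simple_functionD(1)[OF S] by simp
  from ex_bij_betw_nat_finite[OF this] obtain h where "bij_betw h {0..<card (range S - {0})} (range S - {0})"
    by blast
  moreover define m where "m = card (range S - {0})"
  ultimately have "bij_betw h {0..<m} (range S - {0})" by simp
  then have h: "inj_on h {..<m}" "h ` {..<m} = range S - {0}"
    by (auto simp: bij_betw_def lessThan_atLeast0)
  \<comment> \<open>The independence axiom speaks of infinite sequences of sets, so the finitely
    many level sets are padded with empty ones.\<close>
  define B where "B k = (if k < m then S -` {h k} else {})" for k :: nat
  define N where "N k \<omega> = card {i. X i \<omega> \<in> B k}" for k \<omega>
  have nz: "h k \<noteq> 0" if "k < m" for k using h(2) that by auto
  \<comment> \<open>Stated for general \<open>q\<close> because it is used twice: with the identity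
    for the sum over the points, and with 1 - \<open>expneg\<close> for the integral.\<close>
  have decomp: "q (S x) = (\<Sum>k<m. q (h k) * indicator (B k) x)" if "q 0 = 0" for q :: "ennreal \<Rightarrow> ennreal" and x
  proof (cases "S x = 0")
    case True
    then have "x \<notin> B k" for k using nz by (auto simp: B_def)
    then show ?thesis using True that by simp
  next
    case False
    then have "S x \<in> h ` {..<m}" unfolding h(2) by auto
    then obtain k where k: "k < m" "h k = S x" by auto
    have "x \<in> B j \<longleftrightarrow> j = k" if "j < m" for j
      using that k h(1) by (auto simp: B_def inj_on_def)
    then have "(\<Sum>j<m. q (h j) * indicator (B j) x) = (\<Sum>j<m. if j = k then q (h j) else 0)"
      by (intro sum.cong) auto
    then show ?thesis using k by simp
  qed
  have sets[measurable]: "B k \<in> sets borel" for k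
    using simple_functionD(2)[OF S, of "{h k}"] by (auto simp: B_def)
  have bB: "bounded (B k)" for k
    using nz by (auto simp: B_def intro!: bounded_subset[OF bdd])
  have disj: "disjoint_family B"
    using h(1) by (auto simp: disjoint_family_on_def B_def inj_on_def)
  have indep: "indep_vars (\<lambda>_. count_space UNIV) N UNIV"
    using poisson disj sets bB unfolding stationary_poisson_process_def N_def by blast
  then have [measurable]: "N k \<in> M \<rightarrow>\<^sub>M count_space UNIV" for k
    by (auto simp: indep_vars_def)
  have fin: "AE \<omega> in M. \<forall>k. finite {i. X i \<omega> \<in> B k}"
    using poisson bB by (auto simp: stationary_poisson_process_def)
  have "(\<integral>\<^sup>+\<omega>. expneg (\<Sum>i. S (X i \<omega>)) \<partial>M) = (\<integral>\<^sup>+\<omega>. (\<Prod>k<m. expneg (h k * of_nat (N k \<omega>))) \<partial>M)"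
  proof (intro nn_integral_cong_AE, use fin in eventually_elim)
    fix \<omega> assume fin: "\<forall>k. finite {i. X i \<omega> \<in> B k}"
    have *: "(\<Sum>i. indicator (B k) (X i \<omega>)) = (of_nat (N k \<omega>) :: ennreal)" for k
    proof -
      have "(\<Sum>i. indicator (B k) (X i \<omega>)) = (\<Sum>i\<in>{i. X i \<omega> \<in> B k}. indicator (B k) (X i \<omega>) :: ennreal)"
        using fin by (intro suminf_finite) auto
      also have "\<dots> = (\<Sum>i\<in>{i. X i \<omega> \<in> B k}. 1)"
        by (intro sum.cong) auto
      finally show ?thesis by (simp add: N_def)
    qed
    have "(\<Sum>i. S (X i \<omega>)) = (\<Sum>i. \<Sum>k<m. h k * indicator (B k) (X i \<omega>))"
      using decomp[of "\<lambda>x. x"] by simp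
    also have "\<dots> = (\<Sum>k<m. \<Sum>i. h k * indicator (B k) (X i \<omega>))"
      by (rule suminf_sum) auto
    also have "\<dots> = (\<Sum>k<m. h k * of_nat (N k \<omega>))"
      using * by simp
    finally show "expneg (\<Sum>i. S (X i \<omega>)) = (\<Prod>k<m. expneg (h k * of_nat (N k \<omega>)))"
      by (simp add: expneg_sum)
  qed
  also have "\<dots> = (\<Prod>k<m. \<integral>\<^sup>+\<omega>. expneg (h k * of_nat (N k \<omega>)) \<partial>M)"
    by (intro indep_vars_nn_integral indep_vars_compose2[OF indep_vars_subset[OF indep]]) auto
  also have "\<dots> = (\<Prod>k<m. expneg (ennreal l * emeasure lborel (B k) * (1 - expneg (h k))))"
  proof (intro prod.cong refl)
    fix k
    have "(\<integral>\<^sup>+\<omega>. expneg (h k * of_nat (N k \<omega>)) \<partial>M)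
        = expneg (ennreal (l * measure lborel (B k)) * (1 - expneg (h k)))"
      using poisson sets[of k] bB[of k] l_nonneg prob_space_axioms unfolding N_def[symmetric]
      by (intro poisson_expneg) (auto simp: stationary_poisson_process_def N_def)
    also have "ennreal (l * measure lborel (B k)) = ennreal l * emeasure lborel (B k)"
      using l_nonneg emeasure_bounded_finite[OF bB[of k]]
      by (simp add: ennreal_mult emeasure_eq_ennreal_measure)
    finally show "(\<integral>\<^sup>+\<omega>. expneg (h k * of_nat (N k \<omega>)) \<partial>M)
        = expneg (ennreal l * emeasure lborel (B k) * (1 - expneg (h k)))" .
  qed
  also have "\<dots> = expneg (ennreal l * (\<Sum>k<m. (1 - expneg (h k)) * emeasure lborel (B k)))"
    by (simp add: expneg_sum[symmetric] sum_distrib_left ac_simps)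
  also have "(\<Sum>k<m. (1 - expneg (h k)) * emeasure lborel (B k))
      = (\<integral>\<^sup>+x. (\<Sum>k<m. (1 - expneg (h k)) * indicator (B k) x) \<partial>lborel)"
    by (subst nn_integral_sum) (auto simp: nn_integral_cmult_indicator simp del: sum_mult_indicator)
  also have "\<dots> = (\<integral>\<^sup>+x. 1 - expneg (S x) \<partial>lborel)"
    by (simp add: decomp[of "\<lambda>x. 1 - expneg x"])
  finally show ?thesis .
qed

text \<open>Simple functions truncated to growing balls have bounded support and still increase to
  \<open>S\<close>. Both sides then decrease to their limits.\<close>

theorem pgfl:
  assumes [measurable]: "S \<in> borel_measurable borel"
  shows "(\<integral>\<^sup>+\<omega>. expneg (\<Sum>i. S (X i \<omega>)) \<partial>M) = expneg (ennreal l * (\<integral>\<^sup>+x. 1 - expneg (S x) \<partial>lborel))"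
proof -
  obtain f where f: "\<And>n. simple_function borel (f n)" "incseq f" "\<And>x. (SUP n. f n x) = S x"
    using borel_measurable_implies_simple_function_sequence'[OF assms] by metis
  define g where "g n x = f n x * indicator (ball 0 (real n)) x" for n and x :: plane
  have sg: "simple_function borel (g n)" for n
    unfolding g_def by (intro simple_function_mult f) auto
  then have [measurable]: "g n \<in> borel_measurable borel" for n
    by (rule borel_measurable_simple_function)
  have bg: "bounded {x. g n x \<noteq> 0}" for n
    by (intro bounded_subset[OF bounded_ball[of 0 "real n"]]) (auto simp: g_def indicator_def)
  have incg: "incseq (\<lambda>n. g n x)" for x
    using f(2) by (auto simp: incseq_def le_fun_def g_def indicator_def)
  have Sg: "S x = (SUP n. g n x)" for x
  proof (rule antisym)
    obtain m where m: "norm x < real m" using reals_Archimedean2 by blast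
    show "S x \<le> (SUP n. g n x)"
      unfolding f(3)[symmetric]
    proof (rule SUP_mono)
      fix n
      have "f n x \<le> g (max n m) x"
        using m incseqD[OF f(2), of n "max n m"] by (auto simp: g_def le_fun_def)
      then show "\<exists>j\<in>UNIV. f n x \<le> g j x" by blast
    qed
    show "(SUP n. g n x) \<le> S x"
      unfolding f(3)[symmetric] by (intro SUP_mono) (auto simp: g_def indicator_def)
  qed
  have "(\<integral>\<^sup>+\<omega>. expneg (\<Sum>i. S (X i \<omega>)) \<partial>M) = (\<integral>\<^sup>+\<omega>. expneg (SUP n. \<Sum>i. g n (X i \<omega>)) \<partial>M)"
    using incg by (simp add: Sg ennreal_suminf_SUP_eq)
  also have "\<dots> = (INF n. \<integral>\<^sup>+\<omega>. expneg (\<Sum>i. g n (X i \<omega>)) \<partial>M)"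
    using incg by (intro nn_integral_expneg_SUP finite_measure_axioms)
      (auto simp: incseq_def le_fun_def intro!: suminf_le)
  also have "\<dots> = (INF n. expneg (ennreal l * (\<integral>\<^sup>+x. 1 - expneg (g n x) \<partial>lborel)))"
    by (simp add: pgfl_simple[OF sg bg])
  also have "\<dots> = expneg (ennreal l * (\<integral>\<^sup>+x. (SUP n. 1 - expneg (g n x)) \<partial>lborel))"
    using incg
    by (subst nn_integral_monotone_convergence_SUP)
       (auto simp: expneg_SUP SUP_mult_left_ennreal incseq_def le_fun_def intro!: ennreal_minus_mono expneg_antimono)
  also have "(\<lambda>x. SUP n. 1 - expneg (g n x)) = (\<lambda>x. 1 - expneg (S x))"
    by (simp add: Sg expneg_SUP ennreal_INF_const_minus)
  finally show ?thesis .
qed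

text \<open>The Mecke formula for an exponential functional is the derivative at \<open>t = 0\<close> of the
  generating functional of \<open>S + t F\<close>; monotone difference quotients make this valid for all
  measurable \<open>F, S\<close> with values in \<open>[0, \<infinity>]\<close>.\<close>

theorem mecke:
  assumes [measurable]: "F \<in> borel_measurable borel" "S \<in> borel_measurable borel"
  shows "(\<integral>\<^sup>+\<omega>. expneg (\<Sum>i. S (X i \<omega>)) * (\<Sum>i. F (X i \<omega>)) \<partial>M)
    = expneg (ennreal l * (\<integral>\<^sup>+x. 1 - expneg (S x) \<partial>lborel)) * (ennreal l * (\<integral>\<^sup>+x. expneg (S x) * F x \<partial>lborel))"
    (is "_ = ?e * _")
proof -
  \<comment> \<open>For each fixed n the identity is exact: with q = n + 1 it compares the
    generating functional at \<open>S\<close> with that at \<open>S + F / q\<close>.\<close>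
  have quot: "(\<integral>\<^sup>+\<omega>. expneg (\<Sum>i. S (X i \<omega>)) * expneg_quot n (\<Sum>i. F (X i \<omega>)) \<partial>M)
      = ?e * expneg_quot n (ennreal l * (\<integral>\<^sup>+x. expneg (S x) * expneg_quot n (F x) \<partial>lborel))"
    (is "?L = _ * expneg_quot n (_ * ?b)") for n
  proof -
    define q where "q = (of_nat (Suc n) :: ennreal)"
    have q: "q \<noteq> 0" "q \<noteq> \<top>" by (auto simp: q_def simp del: of_nat_Suc)
    let ?e' = "expneg (ennreal l * (\<integral>\<^sup>+x. 1 - expneg (S x + F x / q) \<partial>lborel))"
    let ?d = "ennreal l * (\<integral>\<^sup>+x. expneg (S x) * (1 - expneg (F x / q)) \<partial>lborel)"
    have "?L = (\<integral>\<^sup>+\<omega>. q * (expneg (\<Sum>i. S (X i \<omega>)) - expneg (\<Sum>i. S (X i \<omega>) + F (X i \<omega>) / q)) \<partial>M)"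
    proof (intro nn_integral_cong)
      fix \<omega>
      have "(\<Sum>i. S (X i \<omega>) + F (X i \<omega>) / q) = (\<Sum>i. S (X i \<omega>)) + (\<Sum>i. F (X i \<omega>)) / q"
        by (subst suminf_add[symmetric]) auto
      then show "expneg (\<Sum>i. S (X i \<omega>)) * expneg_quot n (\<Sum>i. F (X i \<omega>))
          = q * (expneg (\<Sum>i. S (X i \<omega>)) - expneg (\<Sum>i. S (X i \<omega>) + F (X i \<omega>) / q))"
        by (simp add: expneg_add expneg_quot_def q_def ennreal_right_diff_distrib mult_ac del: of_nat_Suc)
    qed
    also have "\<dots> = q * (\<integral>\<^sup>+\<omega>. expneg (\<Sum>i. S (X i \<omega>)) - expneg (\<Sum>i. S (X i \<omega>) + F (X i \<omega>) / q) \<partial>M)"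
      by (intro nn_integral_cmult) measurable
    also have "\<dots> = q * (?e - ?e')"
      by (subst nn_integral_diff)
         (auto simp: pgfl pgfl[of "\<lambda>x. S x + F x / q"] intro!: expneg_antimono suminf_le)
    also have "?e' = ?e * expneg ?d"
    proof -
      \<comment> \<open>This identity splits the exponent belonging to \<open>S + F / q\<close> into
        the exponent of \<open>S\<close> plus \<open>?d\<close>, so that \<open>?e\<close> factors
        out of the difference.\<close>
      have split: "1 - a * b = (1 - a) + a * (1 - b)" if "a \<le> 1" "b \<le> 1" for a b :: ennreal
      proof (cases a; cases b)
        fix r s assume rs: "a = ennreal r" "b = ennreal s" "0 \<le> r" "0 \<le> s"
        with that have "r \<le> 1" "s \<le> 1" "r * s \<le> 1" "r * s \<le> r" by (auto intro: mult_le_one mult_left_le)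
        with rs show ?thesis
          by (simp add: ennreal_minus algebra_simps flip: ennreal_1 ennreal_mult ennreal_plus)
      qed (use that in \<open>auto simp: top_unique\<close>)
      have "(\<integral>\<^sup>+x. 1 - expneg (S x + F x / q) \<partial>lborel)
          = (\<integral>\<^sup>+x. 1 - expneg (S x) \<partial>lborel) + (\<integral>\<^sup>+x. expneg (S x) * (1 - expneg (F x / q)) \<partial>lborel)"
        by (subst nn_integral_add[symmetric]) (auto simp: expneg_add split)
      then show ?thesis by (simp add: distrib_left expneg_add)
    qed
    also have "q * (?e - ?e * expneg ?d) = ?e * (q * (1 - expneg ?d))"
      by (simp add: ennreal_right_diff_distrib mult.left_commute)
    also have "?d = ennreal l * ?b / q"
    proof -
      have "?b = (\<integral>\<^sup>+x. q * (expneg (S x) * (1 - expneg (F x / q))) \<partial>lborel)"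
        by (simp add: expneg_quot_def q_def mult.left_commute del: of_nat_Suc)
      also have "\<dots> = q * (\<integral>\<^sup>+x. expneg (S x) * (1 - expneg (F x / q)) \<partial>lborel)"
        by (intro nn_integral_cmult) measurable
      finally show ?thesis
        using q by (simp add: mult.commute[of q] mult.assoc[symmetric] mult_divide_eq_ennreal)
    qed
    finally show ?thesis
      by (simp add: expneg_quot_def q_def del: of_nat_Suc)
  qed
  have "(\<integral>\<^sup>+\<omega>. expneg (\<Sum>i. S (X i \<omega>)) * (\<Sum>i. F (X i \<omega>)) \<partial>M)
      = (\<integral>\<^sup>+\<omega>. (SUP n. expneg (\<Sum>i. S (X i \<omega>)) * expneg_quot n (\<Sum>i. F (X i \<omega>))) \<partial>M)"
    by (simp add: SUP_mult_left_ennreal[symmetric] SUP_expneg_quot)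
  also have "\<dots> = (SUP n. ?e * expneg_quot n (ennreal l * (\<integral>\<^sup>+x. expneg (S x) * expneg_quot n (F x) \<partial>lborel)))"
    unfolding quot[symmetric] using incseq_expneg_quot
    by (intro nn_integral_monotone_convergence_SUP) (auto simp: incseq_def le_fun_def intro!: mult_left_mono)
  also have "\<dots> = ?e * (SUP n. expneg_quot n (ennreal l * (\<integral>\<^sup>+x. expneg (S x) * expneg_quot n (F x) \<partial>lborel)))"
    by (simp add: SUP_mult_left_ennreal)
  also have "(SUP n. expneg_quot n (ennreal l * (\<integral>\<^sup>+x. expneg (S x) * expneg_quot n (F x) \<partial>lborel)))
      = ennreal l * (\<integral>\<^sup>+x. expneg (S x) * F x \<partial>lborel)"
  proof -
    define b where "b n = ennreal l * (\<integral>\<^sup>+x. expneg (S x) * expneg_quot n (F x) \<partial>lborel)" for n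
    have incb: "incseq b"
      unfolding b_def using incseq_expneg_quot
      by (auto simp: incseq_def intro!: mult_left_mono nn_integral_mono)
    have SUPb: "(SUP n. b n) = ennreal l * (\<integral>\<^sup>+x. expneg (S x) * F x \<partial>lborel)"
    proof -
      have "(\<integral>\<^sup>+x. expneg (S x) * F x \<partial>lborel) = (\<integral>\<^sup>+x. (SUP n. expneg (S x) * expneg_quot n (F x)) \<partial>lborel)"
        by (simp add: SUP_mult_left_ennreal[symmetric] SUP_expneg_quot)
      also have "\<dots> = (SUP n. \<integral>\<^sup>+x. expneg (S x) * expneg_quot n (F x) \<partial>lborel)"
        using incseq_expneg_quot
        by (intro nn_integral_monotone_convergence_SUP) (auto simp: incseq_def le_fun_def intro!: mult_left_mono)
      finally show ?thesis by (simp add: b_def SUP_mult_left_ennreal)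
    qed
    \<comment> \<open>The index n occurs in the outer quotient and inside \<open>b n\<close>. Both
      dependences are monotone, so the diagonal supremum equals the iterated one, evaluated by
      \<open>SUP_expneg_quot\<close>.\<close>
    have "(SUP n. expneg_quot n (b n)) = (SUP n. b n)"
    proof (rule antisym)
      show "(SUP n. expneg_quot n (b n)) \<le> (SUP n. b n)"
        by (intro SUP_mono) (auto intro: expneg_quot_le)
      show "(SUP n. b n) \<le> (SUP n. expneg_quot n (b n))"
      proof (rule SUP_least)
        fix m
        have "b m = (SUP n. expneg_quot n (b m))" by (simp add: SUP_expneg_quot)
        also have "\<dots> \<le> (SUP n. expneg_quot n (b n))"
        proof (rule SUP_mono)
          fix n
          have "expneg_quot n (b m) \<le> expneg_quot (max m n) (b m)"
            using incseqD[OF incseq_expneg_quot[of "b m"], of n "max m n"] by simp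
          also have "\<dots> \<le> expneg_quot (max m n) (b (max m n))"
            using incseqD[OF incb, of m "max m n"] by (intro expneg_quot_mono) auto
          finally show "\<exists>j\<in>UNIV. expneg_quot n (b m) \<le> expneg_quot j (b j)" by blast
        qed
        finally show "b m \<le> (SUP n. expneg_quot n (b n))" .
      qed
    qed
    then show ?thesis using SUPb by (simp add: b_def)
  qed
  finally show ?thesis .
qed

end

section \<open>Poisson clusters\<close>

lemma suminf_Suc_ennreal:
  fixes f :: "nat \<Rightarrow> ennreal"
  assumes "f 0 = 0"
  shows "(\<Sum>n. f n) = (\<Sum>n. f (Suc n))"
proof -
  have "(\<lambda>n. f (Suc n)) sums (\<Sum>n. f (Suc n))" by (intro summable_sums) auto
  from sums_Suc[OF this] show ?thesis using assms by (simp add: sums_iff)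
qed

text \<open>Sums with a random number of terms are written as series with vanishing terms, a form
  whose measurability is immediate. Once the number n is fixed, the finite sum is recovered.\<close>

lemma suminf_if_less:
  fixes g :: "nat \<Rightarrow> ennreal"
  shows "(\<Sum>j. if j < n then g j else 0) = (\<Sum>j<n. g j)"
  by (subst suminf_finite[of "{..<n}"]) auto

lemma suminf_if_less_neq:
  fixes g :: "nat \<Rightarrow> ennreal"
  shows "(\<Sum>l. if l < n \<and> l \<noteq> j then g l else 0) = (\<Sum>l\<in>{..<n} - {j}. g l)"
  by (subst suminf_finite[of "{..<n} - {j}"]) auto

locale cluster =
  fixes c :: real and f :: "plane \<Rightarrow> real"
  assumes c_pos: "0 < c" and f: "isotropic_density f"
begin

definition scatter :: "plane measure" where
  "scatter = density lborel (\<lambda>x. ennreal (f x))"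

lemma f_measurable [measurable]: "f \<in> borel_measurable borel"
  and f_nonneg: "0 \<le> f x"
  and f_nn_integral: "(\<integral>\<^sup>+x. ennreal (f x) \<partial>lborel) = 1"
  and f_eq: "norm x = norm y \<Longrightarrow> f x = f y"
  using f unfolding isotropic_density_def by blast+

lemma sets_scatter [measurable_cong, simp]: "sets scatter = sets borel"
  and space_scatter [simp]: "space scatter = UNIV"
  by (auto simp: scatter_def)

sublocale scatter: prob_space scatter
  by (intro prob_spaceI) (simp add: scatter_def emeasure_density f_nn_integral)

lemma nn_integral_scatter:
  "F \<in> borel_measurable borel \<Longrightarrow> (\<integral>\<^sup>+x. F x \<partial>scatter) = (\<integral>\<^sup>+x. ennreal (f x) * F x \<partial>lborel)"
  unfolding scatter_def by (subst nn_integral_density) auto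

sublocale disp: prob_space "\<Pi>\<^sub>M j\<in>(UNIV::nat set). scatter"
  by (intro prob_space_PiM scatter.prob_space_axioms)

lemma cluster_law_eq:
  "cluster_law c f = measure_pmf (poisson_pmf c) \<Otimes>\<^sub>M (\<Pi>\<^sub>M j\<in>UNIV. scatter)"
  by (simp add: cluster_law_def scatter_def)

lemma sets_cluster_law [measurable_cong]:
  "sets (cluster_law c f) = sets (count_space UNIV \<Otimes>\<^sub>M (\<Pi>\<^sub>M j\<in>UNIV. borel))"
  unfolding cluster_law_eq by (intro sets_pair_measure_cong sets_PiM_cong) auto

sublocale cl: prob_space "cluster_law c f"
  unfolding cluster_law_eq
  by (intro prob_space_pair prob_space_measure_pmf disp.prob_space_axioms)

lemma nn_integral_cluster:
  assumes "F \<in> borel_measurable (cluster_law c f)"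
  shows "(\<integral>\<^sup>+\<kappa>. F \<kappa> \<partial>cluster_law c f)
    = (\<Sum>n. ennreal (c ^ n / fact n * exp (- c)) * (\<integral>\<^sup>+D. F (n, D) \<partial>(\<Pi>\<^sub>M j\<in>UNIV. scatter)))"
  using assms c_pos unfolding cluster_law_eq
  by (subst disp.nn_integral_fst[symmetric])
     (auto simp: nn_integral_measure_pmf nn_integral_count_space_nat)

lemma one_minus_nn_integral_expneg:
  assumes [measurable]: "s \<in> borel_measurable borel"
  shows "1 - (\<integral>\<^sup>+x. expneg (s x) \<partial>scatter) = (\<integral>\<^sup>+x. 1 - expneg (s x) \<partial>scatter)"
proof -
  have "(\<integral>\<^sup>+x. expneg (s x) \<partial>scatter) \<le> (\<integral>\<^sup>+x. 1 \<partial>scatter)"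
    by (intro nn_integral_mono) auto
  then have "(\<integral>\<^sup>+x. expneg (s x) \<partial>scatter) \<noteq> \<top>"
    using scatter.emeasure_space_1 by (auto simp: top_unique)
  then have "(\<integral>\<^sup>+x. 1 - expneg (s x) \<partial>scatter) = (\<integral>\<^sup>+x. 1 \<partial>scatter) - (\<integral>\<^sup>+x. expneg (s x) \<partial>scatter)"
    by (intro nn_integral_diff) auto
  then show ?thesis using scatter.emeasure_space_1 by simp
qed

lemma nn_integral_expneg_scatter_le: "(\<integral>\<^sup>+x. expneg (s x) \<partial>scatter) \<le> 1"
proof -
  have "(\<integral>\<^sup>+x. expneg (s x) \<partial>scatter) \<le> (\<integral>\<^sup>+x. 1 \<partial>scatter)"
    by (intro nn_integral_mono) auto
  then show ?thesis using scatter.emeasure_space_1 by simp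
qed

lemma poisson_series_scatter:
  assumes [measurable]: "s \<in> borel_measurable borel"
  shows "(\<Sum>n. ennreal (c ^ n / fact n * exp (- c)) * (\<integral>\<^sup>+x. expneg (s x) \<partial>scatter) ^ n)
    = expneg (ennreal c * (\<integral>\<^sup>+x. 1 - expneg (s x) \<partial>scatter))"
proof -
  obtain p where p: "(\<integral>\<^sup>+x. expneg (s x) \<partial>scatter) = ennreal p" "0 \<le> p" "p \<le> 1"
    using nn_integral_expneg_scatter_le[of s]
    by (cases "\<integral>\<^sup>+x. expneg (s x) \<partial>scatter") (auto simp: top_unique)
  have "(\<Sum>n. ennreal (c ^ n / fact n * exp (- c)) * ennreal p ^ n) = ennreal (exp (- (c * (1 - p))))"
    using poisson_series[of c p] c_pos p by (simp add: ennreal_power mult.commute)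
  also have "\<dots> = expneg (ennreal c * (1 - ennreal p))"
    using p c_pos by (simp add: ennreal_minus flip: ennreal_1 ennreal_mult)
  finally show ?thesis
    by (simp add: p(1)[symmetric] one_minus_nn_integral_expneg)
qed

theorem cluster_pgfl:
  assumes [measurable]: "s \<in> borel_measurable borel"
  shows "(\<integral>\<^sup>+\<kappa>. expneg (\<Sum>l. if l < fst \<kappa> then s (snd \<kappa> l) else 0) \<partial>cluster_law c f)
    = expneg (ennreal c * (\<integral>\<^sup>+x. 1 - expneg (s x) \<partial>scatter))"
proof -
  have "(\<integral>\<^sup>+D. expneg (\<Sum>l. if l < n then s (D l) else 0) \<partial>(\<Pi>\<^sub>M j\<in>UNIV. scatter))
      = (\<integral>\<^sup>+x. expneg (s x) \<partial>scatter) ^ n" for n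
    using nn_integral_PiM_prod[of UNIV "\<lambda>_. scatter" "{..<n}" "\<lambda>_ x. expneg (s x)"]
    by (simp add: suminf_if_less expneg_sum scatter.prob_space_axioms)
  then show ?thesis
    by (subst nn_integral_cluster) (auto simp: poisson_series_scatter simp del: times_divide_eq_left cong: if_cong)
qed

text \<open>The analogue of the Mecke formula for one cluster. Given the size n, each of the n
  choices of a distinguished point contributes the same integral, in which the other n - 1
  displacements are i.i.d. and independent of it. The factor n turns the Poisson weight of n into c
  times that of n - 1, so the other points again form a Poisson cluster. The function
  \<open>s\<close> may depend on the distinguished displacement because points are later viewed from
  it.\<close>

theorem cluster_palm:
  assumes [measurable]: "G \<in> borel_measurable borel" "case_prod s \<in> borel_measurable (borel \<Otimes>\<^sub>M borel)"
  shows "(\<integral>\<^sup>+\<kappa>. (\<Sum>j. if j < fst \<kappa> then G (snd \<kappa> j) *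
       expneg (\<Sum>l. if l < fst \<kappa> \<and> l \<noteq> j then s (snd \<kappa> j) (snd \<kappa> l) else 0) else 0) \<partial>cluster_law c f)
    = ennreal c * (\<integral>\<^sup>+d. G d * expneg (ennreal c * (\<integral>\<^sup>+x. 1 - expneg (s d x) \<partial>scatter)) \<partial>scatter)"
proof -
  let ?P = "\<Pi>\<^sub>M j\<in>(UNIV::nat set). scatter"
  let ?p = "\<lambda>d. \<integral>\<^sup>+x. expneg (s d x) \<partial>scatter"
  let ?w = "\<lambda>n. ennreal (c ^ n / fact n * exp (- c))"
  have single: "(\<integral>\<^sup>+D. G (D j) * expneg (\<Sum>l. if l < n \<and> l \<noteq> j then s (D j) (D l) else 0) \<partial>?P)
      = (\<integral>\<^sup>+d. G d * ?p d ^ (n - 1) \<partial>scatter)" if "j < n" for j n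
  proof -
    have "(\<integral>\<^sup>+D. G (D j) * expneg (\<Sum>l. if l < n \<and> l \<noteq> j then s (D j) (D l) else 0) \<partial>?P)
        = (\<integral>\<^sup>+d. (\<integral>\<^sup>+D. G d * expneg (\<Sum>l. if l < n \<and> l \<noteq> j then s d (D l) else 0) \<partial>?P) \<partial>scatter)"
      by (subst nn_integral_PiM_resample[where i=j])
         (auto simp: scatter.prob_space_axioms suminf_if_less_neq intro!: nn_integral_cong)
    also have "\<dots> = (\<integral>\<^sup>+d. G d * (\<integral>\<^sup>+D. expneg (\<Sum>l. if l < n \<and> l \<noteq> j then s d (D l) else 0) \<partial>?P) \<partial>scatter)"
      by (intro nn_integral_cong nn_integral_cmult) measurable
    also have "\<dots> = (\<integral>\<^sup>+d. G d * ?p d ^ (n - 1) \<partial>scatter)"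
    proof (intro nn_integral_cong arg_cong2[where f="(*)"] refl)
      fix d
      have "card ({..<n} - {j}) = n - 1" using that by simp
      then show "(\<integral>\<^sup>+D. expneg (\<Sum>l. if l < n \<and> l \<noteq> j then s d (D l) else 0) \<partial>?P) = ?p d ^ (n - 1)"
        using nn_integral_PiM_prod[of UNIV "\<lambda>_. scatter" "{..<n} - {j}" "\<lambda>_ x. expneg (s d x)"]
        by (simp add: suminf_if_less_neq expneg_sum scatter.prob_space_axioms)
    qed
    finally show ?thesis .
  qed
  have inner: "(\<integral>\<^sup>+D. (\<Sum>j. if j < n then G (D j) *
       expneg (\<Sum>l. if l < n \<and> l \<noteq> j then s (D j) (D l) else 0) else 0) \<partial>?P)
     = of_nat n * (\<integral>\<^sup>+d. G d * ?p d ^ (n - 1) \<partial>scatter)" for n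
    unfolding suminf_if_less by (subst nn_integral_sum) (auto simp: single)
  \<comment> \<open>Size-biasing of the Poisson law: n + 1 times the weight of n + 1 is c times the
    weight of n.\<close>
  have weight: "?w (Suc n) * of_nat (Suc n) = ennreal c * ?w n" for n
  proof -
    have "c ^ Suc n / fact (Suc n) * exp (- c) * real (Suc n) = c * (c ^ n / fact n * exp (- c))"
      by (simp del: of_nat_Suc)
    then show ?thesis
      using c_pos by (simp add: ennreal_of_nat_eq_real_of_nat del: of_nat_Suc fact_Suc power_Suc flip: ennreal_mult)
  qed
  have "(\<integral>\<^sup>+\<kappa>. (\<Sum>j. if j < fst \<kappa> then G (snd \<kappa> j) *
       expneg (\<Sum>l. if l < fst \<kappa> \<and> l \<noteq> j then s (snd \<kappa> j) (snd \<kappa> l) else 0) else 0) \<partial>cluster_law c f)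
    = (\<Sum>n. ?w n * (of_nat n * (\<integral>\<^sup>+d. G d * ?p d ^ (n - 1) \<partial>scatter)))"
    by (subst nn_integral_cluster) (auto simp: inner cong: if_cong)
  also have "\<dots> = (\<Sum>n. (?w (Suc n) * of_nat (Suc n)) * (\<integral>\<^sup>+d. G d * ?p d ^ n \<partial>scatter))"
    by (subst suminf_Suc_ennreal) (simp_all add: mult.assoc del: of_nat_Suc fact_Suc power_Suc)
  also have "\<dots> = ennreal c * (\<Sum>n. ?w n * (\<integral>\<^sup>+d. G d * ?p d ^ n \<partial>scatter))"
    unfolding weight mult.assoc by simp
  also have "(\<Sum>n. ?w n * (\<integral>\<^sup>+d. G d * ?p d ^ n \<partial>scatter)) = (\<integral>\<^sup>+d. G d * (\<Sum>n. ?w n * ?p d ^ n) \<partial>scatter)"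
    by (simp add: nn_integral_cmult[symmetric] nn_integral_suminf[symmetric] ennreal_suminf_cmult[symmetric] 
        mult.left_commute del: ennreal_suminf_cmult)
  also have "\<dots> = (\<integral>\<^sup>+d. G d * expneg (ennreal c * (\<integral>\<^sup>+x. 1 - expneg (s d x) \<partial>scatter)) \<partial>scatter)"
    by (intro nn_integral_cong) (simp add: poisson_series_scatter del: times_divide_eq_left)
  finally show ?thesis .
qed

end

section \<open>Neyman--Scott processes\<close>

lemma nn_integral_lborel_affine:
  fixes t :: "'a :: euclidean_space"
  assumes [measurable]: "h \<in> borel_measurable borel" and "\<bar>s\<bar> = 1"
  shows "(\<integral>\<^sup>+x. h (t + s *\<^sub>R x) \<partial>lborel) = (\<integral>\<^sup>+x. h x \<partial>lborel)"
proof -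
  have "s \<noteq> 0" using assms by auto
  from lborel_affine[OF this, of t, symmetric]
  have "distr lborel borel (\<lambda>x. t + s *\<^sub>R x) = lborel"
    by (simp add: assms(2) density_1)
  then have "(\<integral>\<^sup>+x. h x \<partial>lborel) = (\<integral>\<^sup>+x. h x \<partial>distr lborel borel (\<lambda>x. t + s *\<^sub>R x))"
    by simp
  then show ?thesis by (simp add: nn_integral_distr)
qed

lemma nn_integral_lborel_translate:
  fixes t :: "'a :: euclidean_space"
  assumes "h \<in> borel_measurable borel"
  shows "(\<integral>\<^sup>+x. h (t + x) \<partial>lborel) = (\<integral>\<^sup>+x. h x \<partial>lborel)"
  using nn_integral_lborel_affine[OF assms, of 1 t] by simp

lemma nn_integral_lborel_reflect:
  fixes t :: "'a :: euclidean_space"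
  assumes "h \<in> borel_measurable borel"
  shows "(\<integral>\<^sup>+x. h (t - x) \<partial>lborel) = (\<integral>\<^sup>+x. h x \<partial>lborel)"
  using nn_integral_lborel_affine[OF assms, of "-1" t] by simp

lemma suminf_remove_ennreal:
  fixes g :: "nat \<Rightarrow> ennreal"
  shows "(\<Sum>m. g m) = g i + (\<Sum>m. if m = i then 0 else g m)"
proof -
  have "(\<Sum>m. g m) = (\<Sum>m. (if m = i then g i else 0) + (if m = i then 0 else g m))"
    by (intro suminf_cong) auto
  also have "\<dots> = (\<Sum>m. if m = i then g i else 0) + (\<Sum>m. if m = i then 0 else g m)"
    by (intro suminf_add[symmetric]) auto
  also have "(\<Sum>m. if m = i then g i else 0) = g i"
    by (subst suminf_finite[of "{i}"]) auto
  finally show ?thesis .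
qed

lemma (in cluster) measurable_cluster_size [measurable (raw)]:
  assumes "h \<in> N \<rightarrow>\<^sub>M cluster_law c f"
  shows "(\<lambda>x. fst (h x)) \<in> N \<rightarrow>\<^sub>M count_space UNIV"
  by (rule measurable_compose[OF assms]) measurable

lemma (in cluster) measurable_displacement [measurable (raw)]:
  assumes "h \<in> N \<rightarrow>\<^sub>M cluster_law c f"
  shows "(\<lambda>x. snd (h x) j) \<in> borel_measurable N"
  by (rule measurable_compose[OF assms]) measurable

section \<open>Palm expectations of exponential functionals, by labels\<close>

locale neyman_scott = poisson_process M l X + cluster c f
  for M :: "'w measure" and l X c f +
  fixes K :: "nat \<Rightarrow> 'w \<Rightarrow> nat \<times> (nat \<Rightarrow> plane)"
  assumes K_measurable [measurable]: "K i \<in> measurable M (cluster_law c f)"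
    and joint: "distr M ((\<Pi>\<^sub>M i\<in>UNIV. borel) \<Otimes>\<^sub>M (\<Pi>\<^sub>M i\<in>UNIV. cluster_law c f))
            (\<lambda>\<omega>. (\<lambda>i. X i \<omega>, \<lambda>i. K i \<omega>))
          = distr M (\<Pi>\<^sub>M i\<in>UNIV. borel) (\<lambda>\<omega> i. X i \<omega>) \<Otimes>\<^sub>M (\<Pi>\<^sub>M i\<in>UNIV. cluster_law c f)"
begin

text \<open>Points are addressed by labels (i, j). \<open>Y i j\<close> is defined for every j, and
  \<open>act i j\<close> says whether the cluster of parent i really has this point. Coinciding
  points count separately until they are ruled out almost surely.\<close>

definition Y :: "nat \<Rightarrow> nat \<Rightarrow> 'w \<Rightarrow> plane" where
  "Y i j \<omega> = X i \<omega> + snd (K i \<omega>) j"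

definition act :: "nat \<Rightarrow> nat \<Rightarrow> 'w \<Rightarrow> bool" where
  "act i j \<omega> \<longleftrightarrow> j < fst (K i \<omega>)"

lemma measurable_Y [measurable]: "Y i j \<in> borel_measurable M"
  unfolding Y_def by measurable

lemma measurable_act [measurable]: "Measurable.pred M (act i j)"
  unfolding act_def by measurable

sublocale cls: prob_space "\<Pi>\<^sub>M i\<in>(UNIV::nat set). cluster_law c f"
  by (intro prob_space_PiM cl.prob_space_axioms)

text \<open>The law equation \<open>joint\<close> in the form in which it is used: the clusters are
  integrated out while the parents stay fixed.\<close>

lemma nn_integral_joint:
  assumes [measurable]: "case_prod F \<in> borel_measurable ((\<Pi>\<^sub>M i\<in>UNIV. borel) \<Otimes>\<^sub>M (\<Pi>\<^sub>M i\<in>UNIV. cluster_law c f))"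
  shows "(\<integral>\<^sup>+\<omega>. F (\<lambda>i. X i \<omega>) (\<lambda>i. K i \<omega>) \<partial>M)
    = (\<integral>\<^sup>+\<omega>. (\<integral>\<^sup>+k. F (\<lambda>i. X i \<omega>) k \<partial>(\<Pi>\<^sub>M i\<in>UNIV. cluster_law c f)) \<partial>M)"
proof -
  let ?A = "(\<Pi>\<^sub>M i\<in>(UNIV::nat set). (borel :: plane measure))"
    and ?C = "\<Pi>\<^sub>M i\<in>(UNIV::nat set). cluster_law c f"
  have [measurable]: "(\<lambda>\<omega> i. X i \<omega>) \<in> M \<rightarrow>\<^sub>M ?A" "(\<lambda>\<omega> i. K i \<omega>) \<in> M \<rightarrow>\<^sub>M ?C"
    by (auto intro!: measurable_PiM_single' simp: cluster_law_eq space_PiM space_pair_measure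
      K_measurable[unfolded cluster_law_eq])
  have "(\<integral>\<^sup>+\<omega>. F (\<lambda>i. X i \<omega>) (\<lambda>i. K i \<omega>) \<partial>M)
      = (\<integral>\<^sup>+p. case_prod F p \<partial>distr M (?A \<Otimes>\<^sub>M ?C) (\<lambda>\<omega>. (\<lambda>i. X i \<omega>, \<lambda>i. K i \<omega>)))"
    by (subst nn_integral_distr) auto
  also have "\<dots> = (\<integral>\<^sup>+x. (\<integral>\<^sup>+k. F x k \<partial>?C) \<partial>distr M ?A (\<lambda>\<omega> i. X i \<omega>))"
    unfolding joint by (subst cls.nn_integral_fst[symmetric]) auto
  also have "\<dots> = (\<integral>\<^sup>+\<omega>. (\<integral>\<^sup>+k. F (\<lambda>i. X i \<omega>) k \<partial>?C) \<partial>M)"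
    by (subst nn_integral_distr) auto
  finally show ?thesis .
qed

text \<open>The function b of the introduction with \<sigma> left general, because a second choice
  of \<sigma> is needed to show that the points are distinct.\<close>

definition cluster_exponent :: "(plane \<Rightarrow> ennreal) \<Rightarrow> plane \<Rightarrow> ennreal" where
  "cluster_exponent \<sigma> x = ennreal c * (\<integral>\<^sup>+d. 1 - expneg (\<sigma> (x + d)) \<partial>scatter)"

lemma measurable_cluster_exponent [measurable]:
  assumes [measurable]: "\<sigma> \<in> borel_measurable borel"
  shows "cluster_exponent \<sigma> \<in> borel_measurable borel"
  unfolding cluster_exponent_def by measurable

text \<open>The contribution of the points of cluster i to the Palm sum, as a function of parents
  \<open>x\<close> and clusters \<open>k\<close> in place of the outcome, so that
  \<open>nn_integral_joint\<close> applies. The point viewed from is removed by its label, not by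
  its position.\<close>

definition palm_summand ::
    "(plane \<Rightarrow> ennreal) \<Rightarrow> plane set \<Rightarrow> nat \<Rightarrow> (nat \<Rightarrow> plane) \<Rightarrow> (nat \<Rightarrow> nat \<times> (nat \<Rightarrow> plane)) \<Rightarrow> ennreal" where
  "palm_summand \<sigma> W i x k = (\<Sum>j. if j < fst (k i) then indicator W (x i + snd (k i) j) *
      expneg (\<Sum>m. \<Sum>l. if l < fst (k m) \<and> (m, l) \<noteq> (i, j)
        then \<sigma> (x m + snd (k m) l - (x i + snd (k i) j)) else 0) else 0)"

lemma measurable_palm_summand:
  assumes [measurable]: "\<sigma> \<in> borel_measurable borel" "W \<in> sets borel"
  shows "case_prod (palm_summand \<sigma> W i) \<in> borel_measurable ((\<Pi>\<^sub>M i\<in>UNIV. borel) \<Otimes>\<^sub>M (\<Pi>\<^sub>M i\<in>UNIV. cluster_law c f))"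
  unfolding palm_summand_def by measurable

text \<open>Cluster i is isolated by resampling. The other clusters give the factors of the parents
  m \<noteq> i by \<open>cluster_pgfl\<close>, and the rest of cluster i gives precisely the missing
  factor m = i by \<open>cluster_palm\<close>. The substitution y = x i + d then leaves i only in
  the weight f(y - x i), which prepares the sum over i for the Mecke formula.\<close>

lemma nn_integral_palm_summand:
  assumes [measurable]: "\<sigma> \<in> borel_measurable borel" "W \<in> sets borel"
  shows "(\<integral>\<^sup>+k. palm_summand \<sigma> W i x k \<partial>(\<Pi>\<^sub>M i\<in>UNIV. cluster_law c f))
    = ennreal c * (\<integral>\<^sup>+y. ennreal (f (y - x i)) * (indicator W y * expneg (\<Sum>m. cluster_exponent \<sigma> (x m - y))) \<partial>lborel)"
proof -
  let ?C = "\<Pi>\<^sub>M i\<in>(UNIV::nat set). cluster_law c f"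
  let ?b = "cluster_exponent \<sigma>"
  let ?S = "\<lambda>y m \<kappa>. if m = i then 0 else \<Sum>l. if l < fst \<kappa> then \<sigma> (x m + snd \<kappa> l - y) else 0"
  \<comment> \<open>The position of the parent cancels in differences of points of the same cluster,
    hence \<open>x i\<close> is absent.\<close>
  let ?own = "\<lambda>\<kappa> j. \<Sum>l. if l < fst \<kappa> \<and> l \<noteq> j then \<sigma> (snd \<kappa> l - snd \<kappa> j) else 0"
  have [measurable]: "palm_summand \<sigma> W i x \<in> borel_measurable ?C"
    unfolding palm_summand_def by measurable
  have others: "(\<integral>\<^sup>+k. expneg (\<Sum>m. ?S y m (k m)) \<partial>?C) = expneg (\<Sum>m. if m = i then 0 else ?b (x m - y))" for y
  proof -
    have "(\<integral>\<^sup>+\<kappa>. expneg (?S y m \<kappa>) \<partial>cluster_law c f) = expneg (if m = i then 0 else ?b (x m - y))" for m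
      using cluster_pgfl[of "\<lambda>d. \<sigma> (x m - y + d)"] cl.emeasure_space_1
      by (auto simp: cluster_exponent_def algebra_simps cong: if_cong)
    then show ?thesis
      using nn_integral_PiM_expneg[of UNIV "\<lambda>_. cluster_law c f" "?S y" "\<lambda>m. if m = i then 0 else ?b (x m - y)"]
      by (simp add: nn_integral_count_space_nat cl.prob_space_axioms)
  qed
  have "(\<integral>\<^sup>+k. palm_summand \<sigma> W i x k \<partial>?C)
      = (\<integral>\<^sup>+\<kappa>. (\<integral>\<^sup>+k. palm_summand \<sigma> W i x (fun_upd k i \<kappa>) \<partial>?C) \<partial>cluster_law c f)"
    by (rule nn_integral_PiM_resample) (auto simp: cl.prob_space_axioms)
  also have "\<dots> = (\<integral>\<^sup>+\<kappa>. (\<integral>\<^sup>+k. (\<Sum>j. if j < fst \<kappa> then indicator W (x i + snd \<kappa> j) * expneg (?own \<kappa> j)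
      * expneg (\<Sum>m. ?S (x i + snd \<kappa> j) m (k m)) else 0) \<partial>?C) \<partial>cluster_law c f)"
  proof (intro nn_integral_cong)
    fix \<kappa> k
    show "palm_summand \<sigma> W i x (fun_upd k i \<kappa>) = (\<Sum>j. if j < fst \<kappa> then indicator W (x i + snd \<kappa> j) * expneg (?own \<kappa> j)
      * expneg (\<Sum>m. ?S (x i + snd \<kappa> j) m (k m)) else 0)"
      unfolding palm_summand_def fun_upd_same
    proof (intro suminf_cong if_cong refl)
      fix j
      let ?g = "\<lambda>m. \<Sum>l. if l < fst ((fun_upd k i \<kappa>) m) \<and> (m, l) \<noteq> (i, j)
        then \<sigma> (x m + snd ((fun_upd k i \<kappa>) m) l - (x i + snd \<kappa> j)) else 0"
      have "(\<Sum>m. ?g m) = ?g i + (\<Sum>m. if m = i then 0 else ?g m)"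
        by (rule suminf_remove_ennreal)
      also have "?g i = ?own \<kappa> j"
        by (auto intro!: suminf_cong)
      also have "(\<Sum>m. if m = i then 0 else ?g m) = (\<Sum>m. ?S (x i + snd \<kappa> j) m (k m))"
        by (auto intro!: suminf_cong)
      finally show "indicator W (x i + snd \<kappa> j) * expneg (\<Sum>m. ?g m) = 
        indicator W (x i + snd \<kappa> j) * expneg (?own \<kappa> j) * expneg (\<Sum>m. ?S (x i + snd \<kappa> j) m (k m))"
        by (simp add: expneg_add mult.assoc)
    qed
  qed
  also have "\<dots> = (\<integral>\<^sup>+\<kappa>. (\<Sum>j. if j < fst \<kappa> then (indicator W (x i + snd \<kappa> j) *
       expneg (\<Sum>m. if m = i then 0 else ?b (x m - (x i + snd \<kappa> j)))) * expneg (?own \<kappa> j) else 0) \<partial>cluster_law c f)"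
  proof (intro nn_integral_cong)
    fix \<kappa>
    show "(\<integral>\<^sup>+k. (\<Sum>j. if j < fst \<kappa> then indicator W (x i + snd \<kappa> j) * expneg (?own \<kappa> j)
          * expneg (\<Sum>m. ?S (x i + snd \<kappa> j) m (k m)) else 0) \<partial>?C)
        = (\<Sum>j. if j < fst \<kappa> then (indicator W (x i + snd \<kappa> j) *
       expneg (\<Sum>m. if m = i then 0 else ?b (x m - (x i + snd \<kappa> j)))) * expneg (?own \<kappa> j) else 0)"
      unfolding suminf_if_less
      by (subst nn_integral_sum) (simp_all add: nn_integral_cmult others[unfolded suminf_if_less] mult_ac)
  qed
  also have "\<dots> = ennreal c * (\<integral>\<^sup>+d. (indicator W (x i + d) * expneg (\<Sum>m. if m = i then 0 else ?b (x m - (x i + d))))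
       * expneg (ennreal c * (\<integral>\<^sup>+y. 1 - expneg (\<sigma> (y - d)) \<partial>scatter)) \<partial>scatter)"
    by (rule cluster_palm) measurable
  also have "\<dots> = ennreal c * (\<integral>\<^sup>+d. indicator W (x i + d) * expneg (\<Sum>m. ?b (x m - (x i + d))) \<partial>scatter)"
  proof (rule arg_cong[where f="(*) (ennreal c)"], intro nn_integral_cong)
    fix d
    \<comment> \<open>Viewed from its point with displacement d, the own parent sits at - d, so the
      term m = i is \<open>?b (- d)\<close>, the exponent left over by the own cluster.\<close>
    have "(\<Sum>m. ?b (x m - (x i + d))) = ?b (- d) + (\<Sum>m. if m = i then 0 else ?b (x m - (x i + d)))"
      by (subst suminf_remove_ennreal[of _ i]) simp
    then show "(indicator W (x i + d) * expneg (\<Sum>m. if m = i then 0 else ?b (x m - (x i + d))))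
       * expneg (ennreal c * (\<integral>\<^sup>+y. 1 - expneg (\<sigma> (y - d)) \<partial>scatter))
       = indicator W (x i + d) * expneg (\<Sum>m. ?b (x m - (x i + d)))"
      by (simp add: expneg_add cluster_exponent_def mult_ac)
  qed
  also have "\<dots> = ennreal c * (\<integral>\<^sup>+d. ennreal (f d) * (indicator W (x i + d) * expneg (\<Sum>m. ?b (x m - (x i + d)))) \<partial>lborel)"
    by (subst nn_integral_scatter) auto
  also have "\<dots> = ennreal c * (\<integral>\<^sup>+y. ennreal (f (y - x i)) * (indicator W y * expneg (\<Sum>m. ?b (x m - y))) \<partial>lborel)"
    using nn_integral_lborel_translate[of "\<lambda>y. ennreal (f (y - x i)) * (indicator W y * expneg (\<Sum>m. ?b (x m - y)))" "x i"]
    by simp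
  finally show ?thesis .
qed

text \<open>For a fixed location y the sum over i is a Mecke sum with F(x) = f(y - x) and exponent
  b(x - y). Translation and reflection invariance remove y from both integrals, so y survives only
  in the indicator of \<open>W\<close> and integrates to the area.\<close>

theorem nn_integral_palm_sum:
  assumes [measurable]: "\<sigma> \<in> borel_measurable borel" "W \<in> sets borel"
  shows "(\<integral>\<^sup>+\<omega>. (\<Sum>i. \<Sum>j. if act i j \<omega> then indicator W (Y i j \<omega>) *
      expneg (\<Sum>m. \<Sum>l. if act m l \<omega> \<and> (m, l) \<noteq> (i, j) then \<sigma> (Y m l \<omega> - Y i j \<omega>) else 0) else 0) \<partial>M)
    = ennreal c * (ennreal l * (emeasure lborel W * (expneg (ennreal l * (\<integral>\<^sup>+x. 1 - expneg (cluster_exponent \<sigma> x) \<partial>lborel))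
        * (\<integral>\<^sup>+d. expneg (cluster_exponent \<sigma> (- d)) \<partial>scatter))))"
proof -
  let ?b = "cluster_exponent \<sigma>"
  let ?C = "\<Pi>\<^sub>M i\<in>(UNIV::nat set). cluster_law c f"
  interpret PS: pair_sigma_finite M lborel by unfold_locales
  let ?V = "expneg (ennreal l * (\<integral>\<^sup>+x. 1 - expneg (?b x) \<partial>lborel))"
  let ?Q = "\<integral>\<^sup>+d. expneg (?b (- d)) \<partial>scatter"
  have [measurable]: "(\<lambda>\<omega>. palm_summand \<sigma> W i (\<lambda>i. X i \<omega>) (\<lambda>i. K i \<omega>)) \<in> borel_measurable M" for i
    unfolding palm_summand_def by measurable
  have "(\<integral>\<^sup>+\<omega>. (\<Sum>i. \<Sum>j. if act i j \<omega> then indicator W (Y i j \<omega>) *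
      expneg (\<Sum>m. \<Sum>l. if act m l \<omega> \<and> (m, l) \<noteq> (i, j) then \<sigma> (Y m l \<omega> - Y i j \<omega>) else 0) else 0) \<partial>M)
    = (\<integral>\<^sup>+\<omega>. (\<Sum>i. palm_summand \<sigma> W i (\<lambda>i. X i \<omega>) (\<lambda>i. K i \<omega>)) \<partial>M)"
    by (simp add: palm_summand_def Y_def act_def cong: if_cong)
  also have "\<dots> = (\<Sum>i. \<integral>\<^sup>+\<omega>. palm_summand \<sigma> W i (\<lambda>i. X i \<omega>) (\<lambda>i. K i \<omega>) \<partial>M)"
    by (rule nn_integral_suminf) measurable
  also have "\<dots> = (\<Sum>i. \<integral>\<^sup>+\<omega>. ennreal c * (\<integral>\<^sup>+y. ennreal (f (y - X i \<omega>)) *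
       (indicator W y * expneg (\<Sum>m. ?b (X m \<omega> - y))) \<partial>lborel) \<partial>M)"
    by (subst nn_integral_joint[OF measurable_palm_summand]) (simp_all add: nn_integral_palm_summand)
  also have "\<dots> = (\<Sum>i. ennreal c * (\<integral>\<^sup>+y. (\<integral>\<^sup>+\<omega>. ennreal (f (y - X i \<omega>)) *
       (indicator W y * expneg (\<Sum>m. ?b (X m \<omega> - y))) \<partial>M) \<partial>lborel))"
    by (subst nn_integral_cmult)
       (auto intro!: suminf_cong arg_cong2[where f="(*)"] PS.Fubini'[symmetric])
  also have "\<dots> = ennreal c * (\<integral>\<^sup>+y. (\<integral>\<^sup>+\<omega>. (\<Sum>i. ennreal (f (y - X i \<omega>)) *
       (indicator W y * expneg (\<Sum>m. ?b (X m \<omega> - y)))) \<partial>M) \<partial>lborel)"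
    by (simp add: nn_integral_suminf[symmetric] del: ennreal_suminf_multc)
  also have "\<dots> = ennreal c * (\<integral>\<^sup>+y. ennreal l * (?V * ?Q) * indicator W y \<partial>lborel)"
  proof (rule arg_cong[where f="(*) (ennreal c)"], intro nn_integral_cong)
    fix y
    have "(\<integral>\<^sup>+\<omega>. (\<Sum>i. ennreal (f (y - X i \<omega>)) * (indicator W y * expneg (\<Sum>m. ?b (X m \<omega> - y)))) \<partial>M)
        = (\<integral>\<^sup>+\<omega>. indicator W y * (expneg (\<Sum>m. ?b (X m \<omega> - y)) * (\<Sum>i. ennreal (f (y - X i \<omega>)))) \<partial>M)"
      by (simp add: mult_ac)
    also have "\<dots> = indicator W y * (\<integral>\<^sup>+\<omega>. expneg (\<Sum>m. ?b (X m \<omega> - y)) * (\<Sum>i. ennreal (f (y - X i \<omega>))) \<partial>M)"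
      by (intro nn_integral_cmult) measurable
    also have "(\<integral>\<^sup>+\<omega>. expneg (\<Sum>m. ?b (X m \<omega> - y)) * (\<Sum>i. ennreal (f (y - X i \<omega>))) \<partial>M)
        = expneg (ennreal l * (\<integral>\<^sup>+x. 1 - expneg (?b (x - y)) \<partial>lborel)) *
          (ennreal l * (\<integral>\<^sup>+x. expneg (?b (x - y)) * ennreal (f (y - x)) \<partial>lborel))"
      by (rule mecke) measurable
    also have "(\<integral>\<^sup>+x. 1 - expneg (?b (x - y)) \<partial>lborel) = (\<integral>\<^sup>+x. 1 - expneg (?b x) \<partial>lborel)"
      using nn_integral_lborel_translate[of "\<lambda>x. 1 - expneg (?b x)" "- y"] by simp
    also have "(\<integral>\<^sup>+x. expneg (?b (x - y)) * ennreal (f (y - x)) \<partial>lborel) = ?Q"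
      using nn_integral_lborel_reflect[of "\<lambda>d. ennreal (f d) * expneg (?b (- d))" y]
      by (subst nn_integral_scatter) (auto simp: mult.commute)
    finally show "(\<integral>\<^sup>+\<omega>. (\<Sum>i. ennreal (f (y - X i \<omega>)) * (indicator W y * expneg (\<Sum>m. ?b (X m \<omega> - y)))) \<partial>M)
        = ennreal l * (?V * ?Q) * indicator W y"
      by (simp add: mult_ac)
  qed
  also have "\<dots> = ennreal c * (ennreal l * (emeasure lborel W * (?V * ?Q)))"
    by (subst nn_integral_cmult_indicator) (auto simp: mult_ac)
  finally show ?thesis .
qed

end

section \<open>Rayleigh fading\<close>

lemma prob_space_fading: "0 < \<mu> \<Longrightarrow> prob_space (fading_law \<mu>)"
  unfolding fading_law_def by (rule prob_space_exponential_density)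

lemma sets_fading [measurable_cong, simp]: "sets (fading_law \<mu>) = sets borel"
  and space_fading [simp]: "space (fading_law \<mu>) = UNIV"
  by (auto simp: fading_law_def)

lemma nn_integral_fading:
  "F \<in> borel_measurable borel \<Longrightarrow>
    (\<integral>\<^sup>+h. F h \<partial>fading_law \<mu>) = (\<integral>\<^sup>+h. ennreal (exponential_density \<mu> h) * F h \<partial>lborel)"
  unfolding fading_law_def by (subst nn_integral_density) auto

lemma nn_integral_exponential_density:
  "0 < \<mu> \<Longrightarrow> (\<integral>\<^sup>+h. ennreal (exponential_density \<mu> h) \<partial>lborel) = 1"
  using prob_space.emeasure_space_1[OF prob_space_exponential_density, of \<mu>]
  by (simp add: emeasure_density)

text \<open>Exponential tilting: multiplying the density of rate \<mu> by exp (- s h) gives \<mu> /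
  (\<mu> + s) times the density of rate \<mu> + s, which has mass 1.\<close>

lemma fading_laplace:
  assumes "0 < \<mu>" "0 \<le> s"
  shows "(\<integral>\<^sup>+h. expneg (ennreal (s * h)) \<partial>fading_law \<mu>) = ennreal (\<mu> / (\<mu> + s))"
proof -
  have "(\<integral>\<^sup>+h. expneg (ennreal (s * h)) \<partial>fading_law \<mu>)
      = (\<integral>\<^sup>+h. ennreal (exponential_density \<mu> h) * expneg (ennreal (s * h)) \<partial>lborel)"
    by (rule nn_integral_fading) measurable
  also have "\<dots> = (\<integral>\<^sup>+h. ennreal (\<mu> / (\<mu> + s)) * ennreal (exponential_density (\<mu> + s) h) \<partial>lborel)"
  proof (intro nn_integral_cong)
    fix h :: real
    show "ennreal (exponential_density \<mu> h) * expneg (ennreal (s * h))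
        = ennreal (\<mu> / (\<mu> + s)) * ennreal (exponential_density (\<mu> + s) h)"
    proof (cases "h < 0")
      case False
      then have "exponential_density \<mu> h * exp (- (s * h)) = \<mu> / (\<mu> + s) * exponential_density (\<mu> + s) h"
      proof -
        have "exp (- h * \<mu>) * exp (- (s * h)) = exp (- h * (\<mu> + s))"
          by (simp add: mult_exp_exp algebra_simps)
        then show ?thesis
          using assms False by (simp add: exponential_density_def mult.assoc)
      qed
      with False show ?thesis
        using assms by (simp add: exponential_density_nonneg flip: ennreal_mult)
    qed (simp add: exponential_density_def)
  qed
  also have "\<dots> = ennreal (\<mu> / (\<mu> + s))"
    using assms by (subst nn_integral_cmult) (simp_all add: nn_integral_exponential_density)
  finally show ?thesis .
qed

text \<open>Memorylessness: on [a, \<infinity>) the density is exp (- \<mu> a) times its own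
  translate by a.\<close>

lemma fading_tail:
  assumes "0 < \<mu>" "0 \<le> a"
  shows "emeasure (fading_law \<mu>) {a..} = ennreal (exp (- (\<mu> * a)))"
proof -
  have "emeasure (fading_law \<mu>) {a..} = (\<integral>\<^sup>+h. ennreal (exponential_density \<mu> h) * indicator {a..} h \<partial>lborel)"
    unfolding fading_law_def by (rule emeasure_density) auto
  also have "\<dots> = (\<integral>\<^sup>+h. ennreal (exp (- (\<mu> * a))) * ennreal (exponential_density \<mu> (- a + h)) \<partial>lborel)"
    using assms
    by (intro nn_integral_cong)
       (auto simp: exponential_density_def indicator_def mult_exp_exp mult.left_commute algebra_simps simp flip: ennreal_mult)
  also have "\<dots> = ennreal (exp (- (\<mu> * a))) * (\<integral>\<^sup>+h. ennreal (exponential_density \<mu> (- a + h)) \<partial>lborel)"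
    by (intro nn_integral_cmult) measurable
  also have "(\<integral>\<^sup>+h. ennreal (exponential_density \<mu> (- a + h)) \<partial>lborel) = 1"
    using nn_integral_lborel_translate[of "\<lambda>h. ennreal (exponential_density \<mu> h)" "- a"] assms
    by (simp add: nn_integral_exponential_density)
  finally show ?thesis by simp
qed

lemma emeasure_fading_success:
  assumes "0 < \<mu>" "0 < T" "0 < G"
  shows "emeasure (fading_law \<mu>) {h. ennreal T \<le> ennreal (h * G) / I} = expneg (ennreal (\<mu> * T / G) * I)"
proof (cases I)
  case (real t)
  show ?thesis
  proof (cases "t = 0")
    case True
    \<comment> \<open>Without interference the quotient is \<top> for h > 0. For h \<le> 0 the
      numerator is 0 in \<open>ennreal\<close>, and 0 / 0 = 0, so h = 0 counts as failure; this
      single value has probability 0.\<close>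
    have "{h. ennreal T \<le> ennreal (h * G) / I} = {0<..}"
      using assms real True by (auto simp: ennreal_zero_divide zero_less_mult_iff not_less mult_le_0_iff ennreal_neg
          intro: ccontr)
    moreover have "emeasure (fading_law \<mu>) {0<..} = emeasure (fading_law \<mu>) {0..}"
    proof (rule emeasure_eq_AE)
      have "AE h in fading_law \<mu>. h \<noteq> 0"
        unfolding fading_law_def using AE_lborel_singleton[of "0::real"]
        by (subst AE_density) (auto elim: eventually_mono)
      then show "AE h in fading_law \<mu>. h \<in> {0<..} \<longleftrightarrow> h \<in> {0..}"
        by eventually_elim auto
    qed auto
    ultimately show ?thesis using fading_tail[of \<mu> 0] assms True real by simp
  next
    case False
    then have t: "t > 0" using real by auto
    have "ennreal T \<le> ennreal (h * G) / I \<longleftrightarrow> T * t / G \<le> h" for h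
    proof (cases "h < 0")
      case True
      then have "\<not> T * t / G \<le> h" using assms t
        by (smt (verit) divide_pos_pos mult_pos_pos)
      moreover have "ennreal (h * G) = 0" using True assms by (simp add: ennreal_neg mult_nonpos_nonneg)
      ultimately show ?thesis using assms by simp
    next
      case False
      then have "ennreal (h * G) / I = ennreal (h * G / t)"
        using t real assms by (simp add: divide_ennreal)
      then show ?thesis using False t assms by (simp add: field_simps)
    qed
    then have "{h. ennreal T \<le> ennreal (h * G) / I} = {T * t / G..}" by auto
    then show ?thesis
      using fading_tail[of \<mu> "T * t / G"] assms real t by (simp add: mult_ac flip: ennreal_mult)
  qed
next
  case top
  then show ?thesis using assms by (simp add: ennreal_mult_top)
qed

text \<open>The function \<open>\<sigma>\<close> of the introduction; the maximum guards against the arbitrary value of \<open>g\<close>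
  at the origin.\<close>

definition log_loss :: "real \<Rightarrow> (plane \<Rightarrow> real) \<Rightarrow> plane \<Rightarrow> plane \<Rightarrow> ennreal" where
  "log_loss T g z x = ennreal (ln (1 + T * max 0 (g (x - z)) / g z))"

text \<open>Integrating the fading of the desired signal first leaves exp (- \<mu> T I / g(z)),
  which is multiplicative over the interferers. Their Laplace transforms then give the factors 1 /
  (1 + T g(x - z) / g(z)). Countability of \<psi> makes the interference measurable.\<close>

lemma success_given_eq:
  assumes "0 < \<mu>" "0 < T" "0 < g z" "countable \<psi>"
  shows "ennreal (success_given \<mu> g T z \<psi>) = expneg (\<integral>\<^sup>+x. log_loss T g z x \<partial>count_space \<psi>)"
proof -
  let ?P = "\<Pi>\<^sub>M x\<in>\<psi>. fading_law \<mu>"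
  interpret F: prob_space "fading_law \<mu>" using assms prob_space_fading by auto
  interpret P: prob_space ?P by (intro prob_space_PiM F.prob_space_axioms)
  interpret FP: pair_prob_space "fading_law \<mu>" ?P by unfold_locales
  have [measurable]: "interference g z \<psi> \<in> borel_measurable ?P"
    unfolding interference_def using assms(4)
    by (intro borel_measurable_nn_integral_count_space) auto
  define A where "A = {p \<in> space (fading_law \<mu> \<Otimes>\<^sub>M ?P). case p of (h, hs) \<Rightarrow>
      ennreal T \<le> ennreal (h * g z) / interference g z \<psi> hs}"
  have [measurable]: "A \<in> sets (fading_law \<mu> \<Otimes>\<^sub>M ?P)"
    unfolding A_def by measurable
  have "ennreal (success_given \<mu> g T z \<psi>) = emeasure (fading_law \<mu> \<Otimes>\<^sub>M ?P) A"
    unfolding success_given_def A_def FP.emeasure_eq_measure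
    by (intro arg_cong[where f=ennreal] arg_cong[where f="measure _"]) auto
  also have "\<dots> = (\<integral>\<^sup>+hs. emeasure (fading_law \<mu>) ((\<lambda>h. (h, hs)) -` A) \<partial>?P)"
    by (rule FP.emeasure_pair_measure_alt2) measurable
  also have "\<dots> = (\<integral>\<^sup>+hs. expneg (\<integral>\<^sup>+x. ennreal (\<mu> * T / g z) * ennreal (hs x * g (x - z)) \<partial>count_space \<psi>) \<partial>?P)"
  proof (intro nn_integral_cong)
    fix hs assume "hs \<in> space ?P"
    then have "(\<lambda>h. (h, hs)) -` A = {h. ennreal T \<le> ennreal (h * g z) / interference g z \<psi> hs}"
      by (auto simp: A_def space_pair_measure)
    then show "emeasure (fading_law \<mu>) ((\<lambda>h. (h, hs)) -` A)
        = expneg (\<integral>\<^sup>+x. ennreal (\<mu> * T / g z) * ennreal (hs x * g (x - z)) \<partial>count_space \<psi>)"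
      using assms by (simp add: emeasure_fading_success interference_def nn_integral_cmult)
  qed
  also have "\<dots> = expneg (\<integral>\<^sup>+x. log_loss T g z x \<partial>count_space \<psi>)"
  proof (rule nn_integral_PiM_expneg)
    fix x
    \<comment> \<open>The argument of the Laplace transform carries the factor \<mu>, so \<mu>
      cancels in \<mu> / (\<mu> + s).\<close>
    define s where "s = \<mu> * (T * max 0 (g (x - z)) / g z)"
    have s: "0 \<le> s" using assms by (simp add: s_def)
    have "(\<integral>\<^sup>+h. expneg (ennreal (\<mu> * T / g z) * ennreal (h * g (x - z))) \<partial>fading_law \<mu>)
        = (\<integral>\<^sup>+h. expneg (ennreal (s * h)) \<partial>fading_law \<mu>)"
    proof (rule nn_integral_cong_AE)
      have "AE h in fading_law \<mu>. 0 \<le> h"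
        unfolding fading_law_def by (subst AE_density) (auto simp: exponential_density_def)
      then show "AE h in fading_law \<mu>. expneg (ennreal (\<mu> * T / g z) * ennreal (h * g (x - z))) = expneg (ennreal (s * h))"
      proof eventually_elim
        fix h :: real assume h: "0 \<le> h"
        show "expneg (ennreal (\<mu> * T / g z) * ennreal (h * g (x - z))) = expneg (ennreal (s * h))"
        proof (cases "g (x - z) \<ge> 0")
          case True
          then have "\<mu> * T / g z * (h * g (x - z)) = s * h" by (simp add: s_def)
          then show ?thesis using True h assms by (simp flip: ennreal_mult)
        next
          case False
          then show ?thesis using h by (simp add: s_def ennreal_neg mult_nonneg_nonpos)
        qed
      qed
    qed
    also have "\<dots> = ennreal (\<mu> / (\<mu> + s))"
      using assms s by (simp add: fading_laplace)
    also have "\<dots> = expneg (log_loss T g z x)"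
    proof -
      define u where "u = T * max 0 (g (x - z)) / g z"
      have "0 \<le> u" using assms by (simp add: u_def)
      moreover have "\<mu> / (\<mu> + s) = inverse (1 + u)"
      proof -
        have "\<mu> + s = \<mu> * (1 + u)" by (simp add: s_def u_def ring_distribs)
        then show ?thesis using assms by (simp add: inverse_eq_divide)
      qed
      ultimately show ?thesis by (simp add: log_loss_def exp_minus flip: u_def)
    qed
    finally show "(\<integral>\<^sup>+h. expneg (ennreal (\<mu> * T / g z) * ennreal (h * g (x - z))) \<partial>fading_law \<mu>)
        = expneg (log_loss T g z x)" .
  qed (use assms in \<open>auto simp: F.prob_space_axioms\<close>)
  finally show ?thesis .
qed

section \<open>Measurability of configurations\<close>

lemma configurations_generator:
  "{{\<psi>. locally_finite \<psi> \<and> card (\<psi> \<inter> B) = n} | B n. B \<in> sets borel \<and> bounded B} \<subseteq> Pow {\<psi>. locally_finite \<psi>}"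
  by auto

lemma space_configurations: "space configurations = {\<psi>. locally_finite \<psi>}"
  unfolding configurations_def by (rule space_measure_of[OF configurations_generator])

lemma countable_locally_finite:
  assumes "locally_finite \<psi>"
  shows "countable \<psi>"
proof -
  have "\<psi> = (\<Union>n::nat. \<psi> \<inter> ball 0 (real n))"
    by (auto simp: reals_Archimedean2)
  moreover have "finite (\<psi> \<inter> ball 0 (real n))" for n
    using assms by (auto simp: locally_finite_def)
  ultimately show ?thesis
    by (metis countable_UN countable_finite countableI_type)
qed

text \<open>The reduction to countably many sets makes local finiteness a measurable event.\<close>

lemma locally_finite_iff: "locally_finite \<psi> \<longleftrightarrow> (\<forall>n::nat. finite (\<psi> \<inter> ball 0 (real n)))"
proof
  assume *: "\<forall>n::nat. finite (\<psi> \<inter> ball 0 (real n))"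
  show "locally_finite \<psi>" unfolding locally_finite_def
  proof (intro allI impI)
    fix B :: "plane set" assume "bounded B"
    then obtain r where "B \<subseteq> ball 0 r" by (metis bounded_subset_ballD)
    moreover obtain n :: nat where "r \<le> real n" using real_arch_simple by blast
    ultimately have "\<psi> \<inter> B \<subseteq> \<psi> \<inter> ball 0 (real n)" by auto
    then show "finite (\<psi> \<inter> B)" using * finite_subset by blast
  qed
qed (auto simp: locally_finite_def)

lemma measurable_card_configurations:
  assumes "B \<in> sets borel" "bounded B"
  shows "(\<lambda>\<psi>. card (\<psi> \<inter> B)) \<in> configurations \<rightarrow>\<^sub>M count_space UNIV"
proof (subst measurable_count_space_eq2_countable, intro conjI ballI)
  fix n
  have "{\<psi>. locally_finite \<psi> \<and> card (\<psi> \<inter> B) = n} \<in> sets configurations"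
    unfolding configurations_def using assms
    by (subst sets_measure_of[OF configurations_generator]) (blast intro: sigma_sets.Basic)
  also have "{\<psi>. locally_finite \<psi> \<and> card (\<psi> \<inter> B) = n} = (\<lambda>\<psi>. card (\<psi> \<inter> B)) -` {n} \<inter> space configurations"
    by (auto simp: space_configurations)
  finally show "(\<lambda>\<psi>. card (\<psi> \<inter> B)) -` {n} \<inter> space configurations \<in> sets configurations" .
qed auto

lemma measurable_nn_integral_configurations:
  assumes "F \<in> borel_measurable borel"
  shows "(\<lambda>\<psi>. \<integral>\<^sup>+x. F x \<partial>count_space \<psi>) \<in> borel_measurable configurations"
  using assms
proof (induction rule: borel_measurable_induct)
  case (cong f g)
  then show ?case by simp
next
  case (set B)
  \<comment> \<open>The generators of the sigma-algebra only provide counts in bounded sets, so the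
    count in \<open>B\<close> is reached through its intersections with balls.\<close>
  have "(\<lambda>\<psi>. SUP n. of_nat (card (\<psi> \<inter> (B \<inter> ball 0 (real n)))) :: ennreal) \<in> borel_measurable configurations"
    using set by (intro borel_measurable_SUP countableI_type measurable_compose[OF measurable_card_configurations])
      (auto intro: bounded_subset[OF bounded_ball])
  also have "?this \<longleftrightarrow> (\<lambda>\<psi>. \<integral>\<^sup>+x. indicator B x \<partial>count_space \<psi>) \<in> borel_measurable configurations"
  proof (rule measurable_cong)
    fix \<psi> assume "\<psi> \<in> space configurations"
    then have fin: "finite (\<psi> \<inter> (B \<inter> ball 0 (real n)))" for n
      by (auto simp: space_configurations locally_finite_def)
    have "(\<integral>\<^sup>+x. indicator B x \<partial>count_space \<psi>) = (\<integral>\<^sup>+x. (SUP n. indicator (\<psi> \<inter> (B \<inter> ball 0 (real n))) x) \<partial>count_space \<psi>)"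
    proof (intro nn_integral_cong antisym)
      fix x assume "x \<in> space (count_space \<psi>)"
      moreover obtain n :: nat where "norm x < n" using reals_Archimedean2 by blast
      ultimately show "indicator B x \<le> (SUP n. indicator (\<psi> \<inter> (B \<inter> ball 0 (real n))) x :: ennreal)"
        by (intro SUP_upper2[of n]) (auto simp: indicator_def)
      show "(SUP n. indicator (\<psi> \<inter> (B \<inter> ball 0 (real n))) x :: ennreal) \<le> indicator B x"
        by (intro SUP_least) (auto simp: indicator_def)
    qed
    also have "\<dots> = (SUP n. \<integral>\<^sup>+x. indicator (\<psi> \<inter> (B \<inter> ball 0 (real n))) x \<partial>count_space \<psi>)"
      by (intro nn_integral_monotone_convergence_SUP) (auto simp: incseq_def le_fun_def indicator_def)
    also have "\<dots> = (SUP n. of_nat (card (\<psi> \<inter> (B \<inter> ball 0 (real n)))))"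
      using fin by simp
    finally show "(SUP n. of_nat (card (\<psi> \<inter> (B \<inter> ball 0 (real n)))) :: ennreal) = (\<integral>\<^sup>+x. indicator B x \<partial>count_space \<psi>)" ..
  qed
  finally show ?case .
next
  case (mult u a)
  then show ?case by (simp add: nn_integral_cmult)
next
  case (add u v)
  then show ?case by (simp add: nn_integral_add)
next
  case (seq U)
  have "(\<integral>\<^sup>+x. (SUP i. U i) x \<partial>count_space \<psi>) = (SUP i. \<integral>\<^sup>+x. U i x \<partial>count_space \<psi>)" for \<psi>
    using seq by (simp add: nn_integral_monotone_convergence_SUP image_comp)
  then show ?case using seq by simp
qed

text \<open>Since the \<open>Z p\<close> may coincide, the cardinality of the set is not a sum of
  indicators. Instead, "at least n distinct points in B" is a countable union over finite index
  sets. Outcomes without local finiteness are sent to the empty set so that the map ends in the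
  space of configurations.\<close>

lemma measurable_enumerated_configuration:
  fixes Z :: "'i::countable \<Rightarrow> 'w \<Rightarrow> plane"
  assumes [measurable]: "\<And>p. Z p \<in> borel_measurable M" "\<And>p. Measurable.pred M (a p)"
  defines "\<Psi> \<omega> \<equiv> {Z p \<omega> | p. a p \<omega>}"
  shows "(\<lambda>\<omega>. if locally_finite (\<Psi> \<omega>) then \<Psi> \<omega> else {}) \<in> M \<rightarrow>\<^sub>M configurations"
proof -
  define enum where "enum B F \<omega> \<longleftrightarrow> (\<forall>p\<in>F. a p \<omega> \<and> Z p \<omega> \<in> B) \<and>
      (\<forall>p\<in>F. \<forall>q\<in>F. p \<noteq> q \<longrightarrow> Z p \<omega> \<noteq> Z q \<omega>)" for B F \<omega>
  define many where "many B n \<omega> \<longleftrightarrow> (\<exists>F\<in>{F. finite F \<and> card F = n}. enum B F \<omega>)" for B n \<omega>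
  have cF: "countable {F::'i set. finite F \<and> card F = n}" for n
    by (rule countable_subset[OF _ countable_Collect_finite]) auto
  have many[measurable]: "Measurable.pred M (many B n)" if [measurable]: "B \<in> sets borel" for B n
  proof -
    have "Measurable.pred M (enum B F)" if "finite F" for F
      unfolding enum_def using that by (intro pred_intros_logic pred_intros_finite) auto
    then have "(\<Union>F\<in>{F. finite F \<and> card F = n}. {\<omega>\<in>space M. enum B F \<omega>}) \<in> sets M"
      by (intro sets.countable_UN'' cF) (auto simp: pred_def)
    also have "(\<Union>F\<in>{F. finite F \<and> card F = n}. {\<omega>\<in>space M. enum B F \<omega>}) = {\<omega>\<in>space M. many B n \<omega>}"
      unfolding many_def by blast
    finally show ?thesis by (simp add: pred_def)
  qed
  have many_iff: "many B n \<omega> \<longleftrightarrow> infinite (\<Psi> \<omega> \<inter> B) \<or> n \<le> card (\<Psi> \<omega> \<inter> B)" for B n \<omega>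
  proof
    assume "many B n \<omega>"
    then obtain F where F: "finite F" "card F = n" "\<forall>p\<in>F. a p \<omega> \<and> Z p \<omega> \<in> B"
        "\<forall>p\<in>F. \<forall>q\<in>F. p \<noteq> q \<longrightarrow> Z p \<omega> \<noteq> Z q \<omega>" by (auto simp: many_def enum_def)
    have "inj_on (\<lambda>p. Z p \<omega>) F" using F(4) unfolding inj_on_def by blast
    then have "card ((\<lambda>p. Z p \<omega>) ` F) = n" using F(2) by (simp add: card_image)
    moreover have "(\<lambda>p. Z p \<omega>) ` F \<subseteq> \<Psi> \<omega> \<inter> B"
      using F(3) by (auto simp: \<Psi>_def)
    ultimately show "infinite (\<Psi> \<omega> \<inter> B) \<or> n \<le> card (\<Psi> \<omega> \<inter> B)"
      using card_mono by metis
  next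
    assume "infinite (\<Psi> \<omega> \<inter> B) \<or> n \<le> card (\<Psi> \<omega> \<inter> B)"
    then obtain S where S: "S \<subseteq> \<Psi> \<omega> \<inter> B" "card S = n" "finite S"
      by (metis infinite_arbitrarily_large obtain_subset_with_card_n)
    then have "\<forall>y\<in>S. \<exists>p. a p \<omega> \<and> y = Z p \<omega>" by (auto simp: \<Psi>_def)
    then obtain s where s: "\<forall>y\<in>S. a (s y) \<omega> \<and> y = Z (s y) \<omega>" by metis
    then have "inj_on s S" by (metis inj_onI)
    then have "card (s ` S) = n" using S card_image by blast
    moreover have "\<forall>p\<in>s ` S. a p \<omega> \<and> Z p \<omega> \<in> B" using s S by auto
    moreover have "\<forall>p\<in>s ` S. \<forall>q\<in>s ` S. p \<noteq> q \<longrightarrow> Z p \<omega> \<noteq> Z q \<omega>" using s by auto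
    ultimately show "many B n \<omega>" using S(3) unfolding many_def enum_def by blast
  qed
  have fin_iff: "finite (\<Psi> \<omega> \<inter> B) \<longleftrightarrow> (\<exists>n. \<not> many B n \<omega>)" for \<omega> B
    unfolding many_iff using Suc_n_not_le_n by blast
  have card_iff: "finite (\<Psi> \<omega> \<inter> B) \<and> card (\<Psi> \<omega> \<inter> B) = n \<longleftrightarrow> many B n \<omega> \<and> \<not> many B (Suc n) \<omega>" for \<omega> B n
    unfolding many_iff by auto
  have lf[measurable]: "Measurable.pred M (\<lambda>\<omega>. locally_finite (\<Psi> \<omega>))"
    unfolding locally_finite_iff fin_iff by measurable
  show ?thesis
    unfolding configurations_def
  proof (rule measurable_measure_of[OF configurations_generator])
    show "(\<lambda>\<omega>. if locally_finite (\<Psi> \<omega>) then \<Psi> \<omega> else {}) \<in> space M \<rightarrow> {\<psi>. locally_finite \<psi>}"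
      by (auto simp: locally_finite_def)
    fix A assume "A \<in> {{\<psi>. locally_finite \<psi> \<and> card (\<psi> \<inter> B) = n} | B n. B \<in> sets borel \<and> bounded B}"
    then obtain B n where A: "A = {\<psi>. locally_finite \<psi> \<and> card (\<psi> \<inter> B) = n}"
      and B[measurable]: "B \<in> sets borel" and bB: "bounded B" by auto
    have "locally_finite (\<Psi> \<omega>) \<and> card (\<Psi> \<omega> \<inter> B) = n \<longleftrightarrow>
        locally_finite (\<Psi> \<omega>) \<and> many B n \<omega> \<and> \<not> many B (Suc n) \<omega>" for \<omega>
      using card_iff[of \<omega> B n] bB by (auto simp: locally_finite_def)
    \<comment> \<open>The substituted empty set lies in \<open>A\<close> exactly when n = 0, which
      explains the extra disjunct below.\<close>
    moreover have "locally_finite {}" by (simp add: locally_finite_def)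
    ultimately have "(\<lambda>\<omega>. if locally_finite (\<Psi> \<omega>) then \<Psi> \<omega> else {}) -` A \<inter> space M
       = {\<omega> \<in> space M. (locally_finite (\<Psi> \<omega>) \<and> many B n \<omega> \<and> \<not> many B (Suc n) \<omega>) \<or> (\<not> locally_finite (\<Psi> \<omega>) \<and> n = 0)}"
      unfolding A by (auto split: if_splits)
    also have "\<dots> \<in> sets M" by measurable
    finally show "(\<lambda>\<omega>. if locally_finite (\<Psi> \<omega>) then \<Psi> \<omega> else {}) -` A \<inter> space M \<in> sets M" .
  qed
qed

section \<open>The reduced Palm distribution\<close>

lemma suminf_suminf_eq_nn_integral:
  "(\<Sum>i. \<Sum>j. g i j) = (\<integral>\<^sup>+p. g (fst p) (snd p) \<partial>count_space (UNIV :: (nat \<times> nat) set))"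
  using nn_integral_fst_count_space[of "\<lambda>p. g (fst p) (snd p)"]
  by (simp add: nn_integral_count_space_nat)

lemma nn_integral_count_space_reindex:
  assumes "inj_on Z P"
  shows "(\<integral>\<^sup>+x. F x \<partial>count_space (Z ` P \<inter> W))
    = (\<integral>\<^sup>+p. (if p \<in> P then indicator W (Z p) * F (Z p) else 0) \<partial>count_space UNIV)"
proof -
  have "bij_betw Z {p\<in>P. Z p \<in> W} (Z ` P \<inter> W)"
    using assms by (auto simp: bij_betw_def inj_on_def)
  then have "(\<integral>\<^sup>+x. F x \<partial>count_space (Z ` P \<inter> W)) = (\<integral>\<^sup>+p. F (Z p) \<partial>count_space {p\<in>P. Z p \<in> W})"
    by (rule nn_integral_bij_count_space[symmetric])
  also have "\<dots> = (\<integral>\<^sup>+p. F (Z p) * indicator {p\<in>P. Z p \<in> W} p \<partial>count_space UNIV)"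
    by (cases "{p\<in>P. Z p \<in> W} = UNIV") (simp_all add: nn_integral_count_space_indicator)
  also have "\<dots> = (\<integral>\<^sup>+p. (if p \<in> P then indicator W (Z p) * F (Z p) else 0) \<partial>count_space UNIV)"
    by (intro nn_integral_cong) (auto simp: indicator_def)
  finally show ?thesis .
qed

section \<open>Almost sure local finiteness and distinctness of the points\<close>

context neyman_scott
begin

definition pt :: "nat \<times> nat \<Rightarrow> 'w \<Rightarrow> plane" where
  "pt p = Y (fst p) (snd p)"

definition alive :: "nat \<times> nat \<Rightarrow> 'w \<Rightarrow> bool" where
  "alive p = act (fst p) (snd p)"

lemma measurable_pt [measurable]: "pt p \<in> borel_measurable M"
  by (simp add: pt_def)

lemma measurable_alive [measurable]: "Measurable.pred M (alive p)"
  by (simp add: alive_def)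

definition intensity :: ennreal where
  "intensity = ennreal c * ennreal l"

lemma intensity_finite: "intensity \<noteq> \<top>"
  by (simp add: intensity_def ennreal_mult_eq_top_iff)

definition palm_value :: "(plane \<Rightarrow> ennreal) \<Rightarrow> ennreal" where
  "palm_value \<sigma> = expneg (ennreal l * (\<integral>\<^sup>+x. 1 - expneg (cluster_exponent \<sigma> x) \<partial>lborel))
        * (\<integral>\<^sup>+d. expneg (cluster_exponent \<sigma> (- d)) \<partial>scatter)"

lemma nn_integral_palm_points:
  assumes "\<sigma> \<in> borel_measurable borel" "W \<in> sets borel"
  shows "(\<integral>\<^sup>+\<omega>. (\<integral>\<^sup>+p. (if alive p \<omega> then indicator W (pt p \<omega>) *
      expneg (\<integral>\<^sup>+q. (if alive q \<omega> \<and> q \<noteq> p then \<sigma> (pt q \<omega> - pt p \<omega>) else 0) \<partial>count_space UNIV) else 0)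
      \<partial>count_space UNIV) \<partial>M) = intensity * emeasure lborel W * palm_value \<sigma>"
  using nn_integral_palm_sum[OF assms]
  by (simp add: suminf_suminf_eq_nn_integral pt_def alive_def intensity_def palm_value_def mult.assoc prod_eq_iff cong: if_cong)

lemma palm_value_eq_1:
  assumes "\<And>x. cluster_exponent \<sigma> x = 0"
  shows "palm_value \<sigma> = 1"
  using scatter.emeasure_space_1 by (simp add: palm_value_def assms)

text \<open>Campbell's formula, obtained from \<sigma> = 0, for which every exponential equals
  1.\<close>

lemma nn_integral_points:
  assumes "W \<in> sets borel"
  shows "(\<integral>\<^sup>+\<omega>. (\<integral>\<^sup>+p. (if alive p \<omega> then indicator W (pt p \<omega>) else 0) \<partial>count_space UNIV) \<partial>M)
    = intensity * emeasure lborel W"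
  using nn_integral_palm_points[of "\<lambda>_. 0" W] assms palm_value_eq_1[of "\<lambda>_. 0"]
  by (simp add: cluster_exponent_def cong: if_cong)

lemma measurable_sum_points [measurable]:
  assumes [measurable]: "\<And>p. h p \<in> borel_measurable M"
  shows "(\<lambda>\<omega>. \<integral>\<^sup>+p. h p \<omega> \<partial>count_space (UNIV :: (nat \<times> nat) set)) \<in> borel_measurable M"
  by (intro borel_measurable_nn_integral_count_space) auto

lemma AE_finite_points:
  assumes "W \<in> sets borel" "bounded W"
  shows "AE \<omega> in M. finite {p. alive p \<omega> \<and> pt p \<omega> \<in> W}"
proof -
  note [measurable] = assms(1)
  have "(\<integral>\<^sup>+\<omega>. (\<integral>\<^sup>+p. (if alive p \<omega> then indicator W (pt p \<omega>) else 0) \<partial>count_space UNIV) \<partial>M) \<noteq> \<infinity>"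
    using nn_integral_points[OF assms(1)] emeasure_bounded_finite[OF assms(2)] intensity_finite
    by (simp add: ennreal_mult_eq_top_iff)
  then have "AE \<omega> in M. (\<integral>\<^sup>+p. (if alive p \<omega> then indicator W (pt p \<omega>) else 0) \<partial>count_space UNIV) \<noteq> \<infinity>"
    by (rule nn_integral_PInf_AE[rotated]) measurable
  then show ?thesis
  proof eventually_elim
    fix \<omega>
    assume "(\<integral>\<^sup>+p. (if alive p \<omega> then indicator W (pt p \<omega>) else 0) \<partial>count_space UNIV) \<noteq> (\<infinity>::ennreal)"
    also have "(\<integral>\<^sup>+p. (if alive p \<omega> then indicator W (pt p \<omega>) else 0) \<partial>count_space UNIV)
        = (\<integral>\<^sup>+p. indicator {p. alive p \<omega> \<and> pt p \<omega> \<in> W} p \<partial>count_space UNIV)"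
      by (intro nn_integral_cong) (auto simp: indicator_def)
    also have "\<dots> = emeasure (count_space UNIV) {p. alive p \<omega> \<and> pt p \<omega> \<in> W}" by simp
    finally show "finite {p. alive p \<omega> \<and> pt p \<omega> \<in> W}" by (auto simp: emeasure_count_space split: if_splits)
  qed
qed

text \<open>Taking \<open>\<sigma> = \<infinity>\<close> at the origin and \<open>0\<close> elsewhere counts only the points which coincide with no
  other point. As this does not change the mean, almost surely all points are distinct.\<close>

lemma AE_distinct_points_bounded:
  assumes "W \<in> sets borel" "bounded W"
  shows "AE \<omega> in M. \<forall>p q. alive p \<omega> \<longrightarrow> pt p \<omega> \<in> W \<longrightarrow> alive q \<omega> \<longrightarrow> q \<noteq> p \<longrightarrow> pt q \<omega> \<noteq> pt p \<omega>"
proof -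
  note [measurable] = assms(1)
  have cancel: "r = 0" if "C \<noteq> \<top>" "C = C + r" for C r :: ennreal
    using that ennreal_add_left_cancel[of C 0 r] by simp
  define \<sigma> :: "plane \<Rightarrow> ennreal" where "\<sigma> x = \<top> * indicator {0} x" for x
  have [measurable]: "\<sigma> \<in> borel_measurable borel" unfolding \<sigma>_def by measurable
  define a :: "nat \<times> nat \<Rightarrow> 'w \<Rightarrow> ennreal" where "a p \<omega> = (if alive p \<omega> then indicator W (pt p \<omega>) else 0)" for p \<omega>
  define e where "e p \<omega> = expneg (\<integral>\<^sup>+q. (if alive q \<omega> \<and> q \<noteq> p then \<sigma> (pt q \<omega> - pt p \<omega>) else 0) \<partial>count_space UNIV)" for p \<omega>
  have [measurable]: "a p \<in> borel_measurable M" "e p \<in> borel_measurable M" for p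
    unfolding a_def e_def by measurable
  \<comment> \<open>The scattering law has a density, so it gives no mass to the single displacement
    - x.\<close>
  have "cluster_exponent \<sigma> x = 0" for x
  proof -
    have "(\<integral>\<^sup>+d. 1 - expneg (\<sigma> (x + d)) \<partial>scatter) = (\<integral>\<^sup>+d. indicator {- x} d \<partial>scatter)"
      by (intro nn_integral_cong) (auto simp: \<sigma>_def indicator_def eq_neg_iff_add_eq_0 add.commute)
    also have "\<dots> = emeasure scatter {- x}" by simp
    also have "\<dots> = 0"
      unfolding scatter_def by (subst emeasure_density) (auto simp: nn_integral_null_set null_setsI)
    finally show ?thesis by (simp add: cluster_exponent_def)
  qed
  then have "(\<integral>\<^sup>+\<omega>. (\<integral>\<^sup>+p. a p \<omega> * e p \<omega> \<partial>count_space UNIV) \<partial>M) = intensity * emeasure lborel W"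
    using nn_integral_palm_points[of \<sigma> W] palm_value_eq_1[of \<sigma>]
    by (simp add: a_def e_def if_distrib[of "\<lambda>t. t * _"] cong: if_cong)
  moreover have "(\<integral>\<^sup>+\<omega>. (\<integral>\<^sup>+p. a p \<omega> \<partial>count_space UNIV) \<partial>M) = intensity * emeasure lborel W"
    using nn_integral_points[of W] by (simp add: a_def)
  moreover have "(\<integral>\<^sup>+\<omega>. (\<integral>\<^sup>+p. a p \<omega> \<partial>count_space UNIV) \<partial>M)
      = (\<integral>\<^sup>+\<omega>. (\<integral>\<^sup>+p. a p \<omega> * e p \<omega> \<partial>count_space UNIV) \<partial>M) + (\<integral>\<^sup>+\<omega>. (\<integral>\<^sup>+p. a p \<omega> * (1 - e p \<omega>) \<partial>count_space UNIV) \<partial>M)"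
  proof (subst nn_integral_add[symmetric])
    \<comment> \<open>With a = a e + a (1 - e) and equal finite means of the sums of a and of a e,
      the remaining part has mean 0.\<close>
    have "a p \<omega> = a p \<omega> * e p \<omega> + a p \<omega> * (1 - e p \<omega>)" for p \<omega>
      by (simp add: e_def distrib_left[symmetric] add_diff_inverse_ennreal)
    then show "(\<integral>\<^sup>+\<omega>. (\<integral>\<^sup>+p. a p \<omega> \<partial>count_space UNIV) \<partial>M) =
      (\<integral>\<^sup>+\<omega>. (\<integral>\<^sup>+p. a p \<omega> * e p \<omega> \<partial>count_space UNIV) + (\<integral>\<^sup>+p. a p \<omega> * (1 - e p \<omega>) \<partial>count_space UNIV) \<partial>M)"
      by (subst nn_integral_add[symmetric]) auto
  qed measurable
  moreover have "intensity * emeasure lborel W \<noteq> \<top>"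
    using emeasure_bounded_finite[OF assms(2)] intensity_finite by (simp add: ennreal_mult_eq_top_iff)
  ultimately have "(\<integral>\<^sup>+\<omega>. (\<integral>\<^sup>+p. a p \<omega> * (1 - e p \<omega>) \<partial>count_space UNIV) \<partial>M) = 0"
    by (intro cancel[of "intensity * emeasure lborel W"]) simp_all
  then have "AE \<omega> in M. (\<integral>\<^sup>+p. a p \<omega> * (1 - e p \<omega>) \<partial>count_space UNIV) = 0"
    by (subst (asm) nn_integral_0_iff_AE) auto
  then show ?thesis
  proof eventually_elim
    fix \<omega> assume "(\<integral>\<^sup>+p. a p \<omega> * (1 - e p \<omega>) \<partial>count_space UNIV) = 0"
    then have zero: "a p \<omega> * (1 - e p \<omega>) = 0" for p
      by (subst (asm) nn_integral_0_iff_AE) (auto simp: AE_count_space simp del: split_paired_All)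
    show "\<forall>p q. alive p \<omega> \<longrightarrow> pt p \<omega> \<in> W \<longrightarrow> alive q \<omega> \<longrightarrow> q \<noteq> p \<longrightarrow> pt q \<omega> \<noteq> pt p \<omega>"
    proof (intro allI impI notI)
      fix p q assume *: "alive p \<omega>" "pt p \<omega> \<in> W" "alive q \<omega>" "q \<noteq> p" "pt q \<omega> = pt p \<omega>"
      let ?h = "\<lambda>q. if alive q \<omega> \<and> q \<noteq> p then \<sigma> (pt q \<omega> - pt p \<omega>) else 0"
      have "?h q \<le> (\<integral>\<^sup>+q. ?h q \<partial>count_space UNIV)"
        by (rule nn_integral_ge_point) simp
      then have "(\<integral>\<^sup>+q. ?h q \<partial>count_space UNIV) = \<top>" using * by (simp add: \<sigma>_def top_unique)
      then have "e p \<omega> = 0" unfolding e_def by simp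
      then show False using zero[of p] * by (simp add: a_def)
    qed
  qed
qed

text \<open>On these outcomes sums over labels and sums over the point set agree.\<close>

definition good :: "'w \<Rightarrow> bool" where
  "good \<omega> \<longleftrightarrow> inj_on (\<lambda>p. pt p \<omega>) {p. alive p \<omega>} \<and> locally_finite ((\<lambda>p. pt p \<omega>) ` {p. alive p \<omega>})"

lemma AE_good: "AE \<omega> in M. good \<omega>"
proof -
  have "AE \<omega> in M. \<forall>n::nat. finite {p. alive p \<omega> \<and> pt p \<omega> \<in> ball 0 (real n)}"
    unfolding AE_all_countable by (intro allI AE_finite_points) auto
  moreover have "AE \<omega> in M. \<forall>n::nat. \<forall>p q. alive p \<omega> \<longrightarrow> pt p \<omega> \<in> ball 0 (real n) \<longrightarrow> alive q \<omega> \<longrightarrow> q \<noteq> p \<longrightarrow> pt q \<omega> \<noteq> pt p \<omega>"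
    by (rule AE_all_countable[THEN iffD2], rule allI, rule AE_distinct_points_bounded) auto
  ultimately show ?thesis
  proof eventually_elim
    case (elim \<omega>)
    have "\<exists>n::nat. pt p \<omega> \<in> ball 0 (real n)" for p
      using reals_Archimedean2[of "norm (pt p \<omega>)"] by auto
    then have "inj_on (\<lambda>p. pt p \<omega>) {p. alive p \<omega>}"
      using elim(2) unfolding inj_on_def by blast
    moreover have "finite ((\<lambda>p. pt p \<omega>) ` {p. alive p \<omega>} \<inter> ball 0 (real n))" for n :: nat
    proof (rule finite_subset)
      show "(\<lambda>p. pt p \<omega>) ` {p. alive p \<omega>} \<inter> ball 0 (real n)
          \<subseteq> (\<lambda>p. pt p \<omega>) ` {p. alive p \<omega> \<and> pt p \<omega> \<in> ball 0 (real n)}" by auto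
    qed (use elim(1) in blast)
    ultimately show ?case by (auto simp: good_def locally_finite_iff)
  qed
qed

text \<open>Here the point is removed by position, as in the reduced Palm distribution, and the set
  has the form required by \<open>measurable_enumerated_configuration\<close>. On good outcomes this
  equals removal by label.\<close>

definition seen_from :: "nat \<times> nat \<Rightarrow> 'w \<Rightarrow> plane set" where
  "seen_from p \<omega> = {pt q \<omega> - pt p \<omega> | q. alive q \<omega> \<and> pt q \<omega> \<noteq> pt p \<omega>}"

definition palm_map :: "nat \<times> nat \<Rightarrow> 'w \<Rightarrow> plane set" where
  "palm_map p \<omega> = (if locally_finite (seen_from p \<omega>) then seen_from p \<omega> else {})"

lemma measurable_palm_map [measurable]: "palm_map p \<in> M \<rightarrow>\<^sub>M configurations"
  unfolding palm_map_def seen_from_def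
  by (rule measurable_enumerated_configuration) measurable

lemma palm_map_good:
  assumes "good \<omega>"
  shows "palm_map p \<omega> = (\<lambda>y. y - pt p \<omega>) ` ((\<lambda>p. pt p \<omega>) ` {p. alive p \<omega>} - {pt p \<omega>})"
proof -
  let ?\<phi> = "(\<lambda>p. pt p \<omega>) ` {p. alive p \<omega>}"
  have eq: "seen_from p \<omega> = (\<lambda>y. y - pt p \<omega>) ` (?\<phi> - {pt p \<omega>})"
    by (auto simp: seen_from_def)
  have "locally_finite (seen_from p \<omega>)"
    unfolding locally_finite_def
  proof (intro allI impI)
    fix B :: "plane set" assume "bounded B"
    then have "bounded ((+) (pt p \<omega>) ` B)" by (rule bounded_translation)
    then have "finite (?\<phi> \<inter> (+) (pt p \<omega>) ` B)"
      using assms by (auto simp: good_def locally_finite_def)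
    then have "finite ((\<lambda>y. y - pt p \<omega>) ` (?\<phi> \<inter> (+) (pt p \<omega>) ` B))" by (rule finite_imageI)
    moreover have "seen_from p \<omega> \<inter> B \<subseteq> (\<lambda>y. y - pt p \<omega>) ` (?\<phi> \<inter> (+) (pt p \<omega>) ` B)"
    proof
      fix y assume "y \<in> seen_from p \<omega> \<inter> B"
      then obtain q where q: "alive q \<omega>" "y = pt q \<omega> - pt p \<omega>" "y \<in> B"
        by (auto simp: seen_from_def)
      then have "pt q \<omega> = pt p \<omega> + y" by simp
      then have "pt q \<omega> \<in> ?\<phi> \<inter> (+) (pt p \<omega>) ` B" using q by blast
      then show "y \<in> (\<lambda>y. y - pt p \<omega>) ` (?\<phi> \<inter> (+) (pt p \<omega>) ` B)" using q by blast
    qed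
    ultimately show "finite (seen_from p \<omega> \<inter> B)"
      by (rule finite_subset[rotated])
  qed
  then show ?thesis by (simp add: palm_map_def eq)
qed

lemma nn_integral_palm_map:
  assumes "good \<omega>" "alive p \<omega>"
  shows "(\<integral>\<^sup>+x. \<sigma> x \<partial>count_space (palm_map p \<omega>))
    = (\<integral>\<^sup>+q. (if alive q \<omega> \<and> q \<noteq> p then \<sigma> (pt q \<omega> - pt p \<omega>) else 0) \<partial>count_space UNIV)"
proof -
  have inj: "inj_on (\<lambda>p. pt p \<omega>) {p. alive p \<omega>}" using assms by (simp add: good_def)
  then have "pt q \<omega> \<noteq> pt p \<omega> \<longleftrightarrow> q \<noteq> p" if "alive q \<omega>" for q
    using that assms(2) unfolding inj_on_def by blast
  then have "palm_map p \<omega> = (\<lambda>q. pt q \<omega> - pt p \<omega>) ` {q. alive q \<omega> \<and> q \<noteq> p} \<inter> UNIV"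
    unfolding palm_map_good[OF assms(1)] by auto
  moreover have inj': "inj_on (\<lambda>q. pt q \<omega> - pt p \<omega>) {q. alive q \<omega> \<and> q \<noteq> p}"
    using inj by (auto simp: inj_on_def)
  ultimately show ?thesis
    using nn_integral_count_space_reindex[OF inj', where F=\<sigma> and W=UNIV] by (simp cong: if_cong)
qed

section \<open>The Palm distribution as an image measure\<close>

abbreviation window :: "plane set" where
  "window \<equiv> cbox 0 One"

lemma emeasure_window: "emeasure lborel window = 1"
  by (subst emeasure_lborel_cbox) (auto simp: inner_Basis)

definition palm_weight :: "nat \<times> nat \<Rightarrow> 'w \<Rightarrow> ennreal" where
  "palm_weight p \<omega> = (if alive p \<omega> then indicator window (pt p \<omega>) else 0) / intensity"

lemma measurable_palm_weight [measurable]: "palm_weight p \<in> borel_measurable M"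
  unfolding palm_weight_def by measurable

text \<open>A pair (label, outcome) is weighted by whether its point lies in the window, then mapped
  to the configuration seen from that point. As an image of a density it is a measure by
  construction.\<close>

definition palm_law :: "plane set measure" where
  "palm_law = distr (density (count_space UNIV \<Otimes>\<^sub>M M) (\<lambda>(p, \<omega>). palm_weight p \<omega>)) configurations
    (\<lambda>(p, \<omega>). palm_map p \<omega>)"

lemma nn_integral_palm_law:
  assumes [measurable]: "F \<in> borel_measurable configurations"
  shows "(\<integral>\<^sup>+\<psi>. F \<psi> \<partial>palm_law) = (\<integral>\<^sup>+\<omega>. (\<integral>\<^sup>+p. palm_weight p \<omega> * F (palm_map p \<omega>) \<partial>count_space UNIV) \<partial>M)"
proof -
  interpret C: sigma_finite_measure "count_space (UNIV :: (nat \<times> nat) set)"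
    by (rule sigma_finite_measure_count_space_countable) auto
  interpret P: pair_sigma_finite "count_space (UNIV :: (nat \<times> nat) set)" M ..
  have [measurable]: "(\<lambda>(p, \<omega>). palm_map p \<omega>) \<in> count_space UNIV \<Otimes>\<^sub>M M \<rightarrow>\<^sub>M configurations"
     "(\<lambda>(p, \<omega>). palm_weight p \<omega>) \<in> borel_measurable (count_space UNIV \<Otimes>\<^sub>M M)"
    by (rule measurable_pair_measure_countable1; simp)+
  have "(\<integral>\<^sup>+\<psi>. F \<psi> \<partial>palm_law) = (\<integral>\<^sup>+(p, \<omega>). palm_weight p \<omega> * F (palm_map p \<omega>) \<partial>(count_space UNIV \<Otimes>\<^sub>M M))"
    unfolding palm_law_def
    by (subst nn_integral_distr, simp, simp, subst nn_integral_density) (auto intro!: nn_integral_cong)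
  also have "\<dots> = (\<integral>\<^sup>+\<omega>. (\<integral>\<^sup>+p. palm_weight p \<omega> * F (palm_map p \<omega>) \<partial>count_space UNIV) \<partial>M)"
    by (subst P.nn_integral_snd[symmetric]) auto
  finally show ?thesis .
qed

lemma sets_palm_law [simp]: "sets palm_law = sets configurations"
  and space_palm_law [simp]: "space palm_law = space configurations"
  by (simp_all add: palm_law_def)

text \<open>\<open>measure_of\<close> depends only on the values of the set function on measurable
  sets, and there these are the values of the measure \<open>palm_law\<close>. The passage from
  points to labels is made on good outcomes, which suffices under the integral.\<close>

lemma reduced_palm_eq:
  assumes \<phi>: "\<And>\<omega>. \<omega> \<in> space M \<Longrightarrow> \<phi> \<omega> = (\<Union>i::nat. {X i \<omega> + snd (K i \<omega>) j | j. j < fst (K i \<omega>)})"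
  shows "reduced_palm M \<phi> = palm_law"
proof -
  have \<phi>_eq: "\<phi> \<omega> = (\<lambda>p. pt p \<omega>) ` {p. alive p \<omega>}" if "\<omega> \<in> space M" for \<omega>
    unfolding \<phi>[OF that] by (auto simp: pt_def alive_def Y_def act_def image_iff) blast
  have window: "window \<in> sets borel" by simp
  have den: "(\<integral>\<^sup>+\<omega>. emeasure (count_space UNIV) (\<phi> \<omega> \<inter> window) \<partial>M) = intensity"
  proof -
    have "(\<integral>\<^sup>+\<omega>. emeasure (count_space UNIV) (\<phi> \<omega> \<inter> window) \<partial>M)
        = (\<integral>\<^sup>+\<omega>. (\<integral>\<^sup>+p. (if alive p \<omega> then indicator window (pt p \<omega>) else 0) \<partial>count_space UNIV) \<partial>M)"
    proof (intro nn_integral_cong_AE, use AE_good AE_space in eventually_elim)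
      fix \<omega> assume "good \<omega>" "\<omega> \<in> space M"
      then have "inj_on (\<lambda>p. pt p \<omega>) {p. alive p \<omega>}" by (simp add: good_def)
      from nn_integral_count_space_reindex[OF this, where F="\<lambda>_. 1" and W=window]
      have "emeasure (count_space (\<phi> \<omega> \<inter> window)) (\<phi> \<omega> \<inter> window)
        = (\<integral>\<^sup>+p. (if alive p \<omega> then indicator window (pt p \<omega>) else 0) \<partial>count_space UNIV)"
        using \<phi>_eq[OF \<open>\<omega> \<in> space M\<close>] by (simp cong: if_cong)
      then show "emeasure (count_space UNIV) (\<phi> \<omega> \<inter> window)
        = (\<integral>\<^sup>+p. (if alive p \<omega> then indicator window (pt p \<omega>) else 0) \<partial>count_space UNIV)"
        by (simp add: emeasure_count_space)
    qed
    then show ?thesis by (simp add: nn_integral_points emeasure_window)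
  qed
  have num: "(\<integral>\<^sup>+\<omega>. (\<integral>\<^sup>+x. indicator A ((\<lambda>y. y - x) ` (\<phi> \<omega> - {x})) \<partial>count_space (\<phi> \<omega> \<inter> window)) \<partial>M) / intensity
      = emeasure palm_law A" if [measurable]: "A \<in> sets configurations" for A
  proof -
    have "(\<integral>\<^sup>+\<omega>. (\<integral>\<^sup>+x. indicator A ((\<lambda>y. y - x) ` (\<phi> \<omega> - {x})) \<partial>count_space (\<phi> \<omega> \<inter> window)) \<partial>M)
        = (\<integral>\<^sup>+\<omega>. (\<integral>\<^sup>+p. (if alive p \<omega> then indicator window (pt p \<omega>) else 0) * indicator A (palm_map p \<omega>) \<partial>count_space UNIV) \<partial>M)"
    proof (intro nn_integral_cong_AE, use AE_good AE_space in eventually_elim)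
      fix \<omega> assume *: "good \<omega>" "\<omega> \<in> space M"
      then have "inj_on (\<lambda>p. pt p \<omega>) {p. alive p \<omega>}" by (simp add: good_def)
      from nn_integral_count_space_reindex[OF this, where F="\<lambda>x. indicator A ((\<lambda>y. y - x) ` (\<phi> \<omega> - {x}))" and W=window]
      show "(\<integral>\<^sup>+x. indicator A ((\<lambda>y. y - x) ` (\<phi> \<omega> - {x})) \<partial>count_space (\<phi> \<omega> \<inter> window))
        = (\<integral>\<^sup>+p. (if alive p \<omega> then indicator window (pt p \<omega>) else 0) * indicator A (palm_map p \<omega>) \<partial>count_space UNIV)"
        unfolding palm_map_good[OF *(1)] \<phi>_eq[OF *(2), symmetric]
        by (simp add: if_distrib[of "\<lambda>t. t * _"] cong: if_cong)
    qed
    then have "(\<integral>\<^sup>+\<omega>. (\<integral>\<^sup>+x. indicator A ((\<lambda>y. y - x) ` (\<phi> \<omega> - {x})) \<partial>count_space (\<phi> \<omega> \<inter> window)) \<partial>M) / intensity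
      = (\<integral>\<^sup>+\<omega>. (\<integral>\<^sup>+p. palm_weight p \<omega> * indicator A (palm_map p \<omega>) \<partial>count_space UNIV) \<partial>M)"
      by (simp add: nn_integral_divide[symmetric] palm_weight_def ennreal_divide_times ennreal_times_divide mult.commute)
    also have "\<dots> = (\<integral>\<^sup>+\<psi>. indicator A \<psi> \<partial>palm_law)"
      by (subst nn_integral_palm_law) auto
    finally show ?thesis by simp
  qed
  have "reduced_palm M \<phi> = measure_of (space configurations) (sets configurations) (emeasure palm_law)"
    unfolding reduced_palm_def den
    by (intro measure_of_eq sets.space_closed) (simp add: num sets.sigma_sets_eq)
  also have "\<dots> = palm_law"
    using measure_of_of_measure[of palm_law] by simp
  finally show ?thesis .
qed

theorem success_prob_eq:
  assumes \<phi>: "\<And>\<omega>. \<omega> \<in> space M \<Longrightarrow> \<phi> \<omega> = (\<Union>i::nat. {X i \<omega> + snd (K i \<omega>) j | j. j < fst (K i \<omega>)})"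
    and "0 < l" "0 < \<mu>" "0 < T" "0 < g z" and [measurable]: "g \<in> borel_measurable borel"
  shows "success_prob M \<phi> \<mu> g T z = enn2real (palm_value (log_loss T g z))"
proof -
  let ?\<sigma> = "log_loss T g z"
  have [measurable]: "?\<sigma> \<in> borel_measurable borel" unfolding log_loss_def by measurable
  have eq: "ennreal (success_given \<mu> g T z \<psi>) = expneg (\<integral>\<^sup>+x. ?\<sigma> x \<partial>count_space \<psi>)"
    if "locally_finite \<psi>" for \<psi>
    using assms countable_locally_finite[OF that] by (intro success_given_eq) auto
  \<comment> \<open>Measurability of \<open>success_given\<close> in \<psi> is read off the closed
    form, because its definition uses a product space that varies with \<psi>.\<close>
  have "(\<lambda>\<psi>. enn2real (expneg (\<integral>\<^sup>+x. ?\<sigma> x \<partial>count_space \<psi>))) \<in> borel_measurable configurations"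
    using measurable_nn_integral_configurations[of ?\<sigma>] by measurable
  moreover have nonneg: "0 \<le> success_given \<mu> g T z \<psi>" for \<psi>
    by (simp add: success_given_def)
  ultimately have [measurable]: "success_given \<mu> g T z \<in> borel_measurable configurations"
    by (subst measurable_cong[where g="\<lambda>\<psi>. enn2real (expneg (\<integral>\<^sup>+x. ?\<sigma> x \<partial>count_space \<psi>))"])
       (auto simp: space_configurations eq[symmetric])
  have i0: "intensity \<noteq> 0" using assms c_pos by (simp add: intensity_def)
  have lf: "locally_finite (palm_map p \<omega>)" for p \<omega>
    by (auto simp: palm_map_def locally_finite_def)
  have "(\<integral>\<^sup>+\<psi>. ennreal (success_given \<mu> g T z \<psi>) \<partial>palm_law)
      = (\<integral>\<^sup>+\<omega>. (\<integral>\<^sup>+p. palm_weight p \<omega> * expneg (\<integral>\<^sup>+x. ?\<sigma> x \<partial>count_space (palm_map p \<omega>)) \<partial>count_space UNIV) \<partial>M)"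
    by (subst nn_integral_palm_law) (auto simp: eq lf)
  also have "\<dots> = (\<integral>\<^sup>+\<omega>. (\<integral>\<^sup>+p. (if alive p \<omega> then indicator window (pt p \<omega>) *
      expneg (\<integral>\<^sup>+q. (if alive q \<omega> \<and> q \<noteq> p then ?\<sigma> (pt q \<omega> - pt p \<omega>) else 0) \<partial>count_space UNIV) else 0)
      \<partial>count_space UNIV) / intensity \<partial>M)"
  proof (intro nn_integral_cong_AE, use AE_good in eventually_elim)
    fix \<omega> assume "good \<omega>"
    then show "(\<integral>\<^sup>+p. palm_weight p \<omega> * expneg (\<integral>\<^sup>+x. ?\<sigma> x \<partial>count_space (palm_map p \<omega>)) \<partial>count_space UNIV)
      = (\<integral>\<^sup>+p. (if alive p \<omega> then indicator window (pt p \<omega>) *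
      expneg (\<integral>\<^sup>+q. (if alive q \<omega> \<and> q \<noteq> p then ?\<sigma> (pt q \<omega> - pt p \<omega>) else 0) \<partial>count_space UNIV) else 0)
      \<partial>count_space UNIV) / intensity"
      by (subst nn_integral_divide[symmetric])
         (auto intro!: nn_integral_cong simp: palm_weight_def nn_integral_palm_map ennreal_divide_times ennreal_times_divide mult.commute)
  qed
  also have "\<dots> = (\<integral>\<^sup>+\<omega>. (\<integral>\<^sup>+p. (if alive p \<omega> then indicator window (pt p \<omega>) *
      expneg (\<integral>\<^sup>+q. (if alive q \<omega> \<and> q \<noteq> p then ?\<sigma> (pt q \<omega> - pt p \<omega>) else 0) \<partial>count_space UNIV) else 0)
      \<partial>count_space UNIV) \<partial>M) / intensity"
    by (rule nn_integral_divide) measurable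
  also have "\<dots> = intensity * palm_value ?\<sigma> / intensity"
    by (subst nn_integral_palm_points) (auto simp: emeasure_window)
  also have "\<dots> = palm_value ?\<sigma>"
    using i0 intensity_finite by (simp add: mult.commute[of intensity] mult_divide_eq_ennreal)
  finally have "(\<integral>\<^sup>+\<psi>. ennreal (success_given \<mu> g T z \<psi>) \<partial>palm_law) = palm_value ?\<sigma>" .
  moreover have "success_given \<mu> g T z \<in> borel_measurable palm_law"
    by (simp cong: measurable_cong_sets)
  moreover have "reduced_palm M \<phi> = palm_law" by (rule reduced_palm_eq) (rule \<phi>)
  ultimately show ?thesis
    unfolding success_prob_def
    by (subst integral_eq_nn_integral) (use nonneg in auto)
qed

end

section \<open>The lower bound\<close>

lemma expneg_nn_integral_le:
  assumes "prob_space N" and [measurable]: "h \<in> borel_measurable N"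
  shows "expneg (\<integral>\<^sup>+x. h x \<partial>N) \<le> (\<integral>\<^sup>+x. expneg (h x) \<partial>N)"
proof (cases "\<integral>\<^sup>+x. h x \<partial>N")
  case (real m)
  interpret prob_space N by fact
  \<comment> \<open>the tangent of \<open>exp (- t)\<close> at the mean \<open>m\<close>, written without subtraction\<close>
  have tangent: "ennreal (exp (- m) * (1 + m)) \<le> expneg t + ennreal (exp (- m)) * t" for t
  proof (cases t)
    case (real r)
    have "exp (- m) * (1 + (m - r)) \<le> exp (- m) * exp (m - r)"
      by (intro mult_left_mono exp_ge_add_one_self) auto
    also have "\<dots> = exp (- r)" by (simp add: mult_exp_exp)
    finally have "exp (- m) * (1 + m) \<le> exp (- r) + exp (- m) * r" by (simp add: algebra_simps)
    with real show ?thesis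
      by (simp add: ennreal_leI flip: ennreal_mult ennreal_plus)
  qed (simp add: ennreal_mult_top)
  have "ennreal (exp (- m) * (1 + m)) = (\<integral>\<^sup>+x. ennreal (exp (- m) * (1 + m)) \<partial>N)"
    by (simp add: emeasure_space_1)
  also have "\<dots> \<le> (\<integral>\<^sup>+x. expneg (h x) + ennreal (exp (- m)) * h x \<partial>N)"
    by (intro nn_integral_mono tangent)
  also have "\<dots> = (\<integral>\<^sup>+x. expneg (h x) \<partial>N) + ennreal (exp (- m)) * ennreal m"
    by (subst nn_integral_add) (auto simp: nn_integral_cmult real)
  finally have "ennreal (exp (- m)) + ennreal (exp (- m) * m) \<le> (\<integral>\<^sup>+x. expneg (h x) \<partial>N) + ennreal (exp (- m) * m)"
    using real by (simp add: ring_distribs flip: ennreal_plus ennreal_mult)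
  then have "ennreal (exp (- m)) \<le> (\<integral>\<^sup>+x. expneg (h x) \<partial>N)"
    by (simp add: add.commute[of _ "ennreal (exp (- m) * m)"] ennreal_add_left_cancel_le)
  then show ?thesis using real by simp
qed simp

section \<open>The integral in the Poisson success probability\<close>

lemma path_loss_measurable: "path_loss g \<Longrightarrow> g \<in> borel_measurable borel"
  unfolding path_loss_def
  by (intro borel_measurable_continuous_countable_exceptions[of "{0}"]) auto

lemma path_loss_pos: "path_loss g \<Longrightarrow> x \<noteq> 0 \<Longrightarrow> 0 < g x"
  unfolding path_loss_def by blast

text \<open>Without integrability the Bochner integral in \<open>poisson_success\<close> would be 0
  by convention. The integrand is at most 1, which serves on the unit ball where g may be unbounded,
  and at most T g(y) / g(z), which is integrable off the ball.\<close>

lemma integrable_outage: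
  assumes g: "path_loss g" and z: "z \<noteq> 0" and T: "0 < T"
  shows "integrable lborel (\<lambda>y. g y / (g z / T + g y))"
proof (rule Bochner_Integration.integrable_bound)
  note [measurable] = path_loss_measurable[OF g]
  have gz: "0 < g z" using path_loss_pos[OF g z] .
  have "set_integrable lborel (- ball 0 1) g" using g unfolding path_loss_def by simp
  then have "integrable lborel (\<lambda>y. T / g z * (indicator (- ball 0 1) y * g y))"
    unfolding set_integrable_def by simp
  moreover have "integrable lborel (\<lambda>y::plane. indicator (ball 0 1) y :: real)"
    using emeasure_bounded_finite[OF bounded_ball[of "0::plane" 1]] by (simp add: less_top)
  ultimately show "integrable lborel (\<lambda>y. indicator (ball 0 1) y + T / g z * (indicator (- ball 0 1) y * g y))"
    by (rule Bochner_Integration.integrable_add[rotated])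
  show "AE y in lborel. norm (g y / (g z / T + g y)) \<le> norm (indicator (ball 0 1) y + T / g z * (indicator (- ball 0 1) y * g y))"
    using AE_lborel_singleton[of "0::plane"]
  proof eventually_elim
    fix y :: plane assume "y \<noteq> 0"
    then have gy: "0 < g y" using path_loss_pos[OF g] by auto
    have "g y / (g z / T + g y) \<le> 1" using gz gy T by (simp add: divide_le_eq add_pos_pos)
    moreover have "g y / (g z / T + g y) \<le> g y / (g z / T)"
      using gz gy T by (intro divide_left_mono mult_pos_pos add_pos_pos divide_pos_pos) auto
    ultimately show "norm (g y / (g z / T + g y)) \<le> norm (indicator (ball 0 1) y + T / g z * (indicator (- ball 0 1) y * g y))"
      using gz gy T by (cases "y \<in> ball 0 1") (auto simp: mult.commute)
  qed
qed (use path_loss_measurable[OF g] in measurable)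

lemma outage_nonneg_AE:
  assumes g: "path_loss g" and z: "z \<noteq> 0" and T: "0 < T"
  shows "AE y in lborel. 0 \<le> g y / (g z / T + g y)"
  using AE_lborel_singleton[of "0::plane"]
proof eventually_elim
  fix y :: plane assume "y \<noteq> 0"
  then show "0 \<le> g y / (g z / T + g y)"
    using path_loss_pos[OF g] z T by (simp add: less_imp_le)
qed

lemma nn_integral_outage:
  assumes g: "path_loss g" and z: "z \<noteq> 0" and T: "0 < T"
  shows "(\<integral>\<^sup>+x. 1 - expneg (log_loss T g z x) \<partial>lborel) = ennreal (\<integral>y. g y / (g z / T + g y) \<partial>lborel)"
proof -
  note [measurable] = path_loss_measurable[OF g]
  have gz: "0 < g z" using path_loss_pos[OF g z] .
  have "(\<integral>\<^sup>+x. 1 - expneg (log_loss T g z x) \<partial>lborel) = (\<integral>\<^sup>+x. ennreal (g (- z + x) / (g z / T + g (- z + x))) \<partial>lborel)"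
  proof (intro nn_integral_cong_AE, use AE_lborel_singleton[of z] in eventually_elim)
    fix x assume "x \<noteq> z"
    then have gx: "0 < g (x - z)" using path_loss_pos[OF g] by auto
    then have "0 \<le> T * g (x - z) / g z" using gz T by simp
    then have "1 - expneg (log_loss T g z x) = ennreal (1 - inverse (1 + T * g (x - z) / g z))"
      using gx by (simp add: log_loss_def exp_minus ennreal_minus flip: ennreal_1)
    also have "1 - inverse (1 + T * g (x - z) / g z) = g (x - z) / (g z / T + g (x - z))"
    proof -
      have "g z + T * g (x - z) \<noteq> 0" using gx gz T by (smt (verit) mult_pos_pos)
      then show ?thesis using gx gz T by (simp add: divide_simps) (simp add: algebra_simps)
    qed
    finally show "1 - expneg (log_loss T g z x) = ennreal (g (- z + x) / (g z / T + g (- z + x)))"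
      by simp
  qed
  also have "\<dots> = (\<integral>\<^sup>+y. ennreal (g y / (g z / T + g y)) \<partial>lborel)"
    by (rule nn_integral_lborel_translate) measurable
  also have "\<dots> = ennreal (\<integral>y. g y / (g z / T + g y) \<partial>lborel)"
    by (intro nn_integral_eq_integral integrable_outage outage_nonneg_AE assms)
  finally show ?thesis .
qed

section \<open>Lower bounds for the two factors of the Palm value\<close>

context neyman_scott
begin

lemma nn_integral_cluster_exponent:
  assumes [measurable]: "\<sigma> \<in> borel_measurable borel"
  shows "(\<integral>\<^sup>+x. cluster_exponent \<sigma> x \<partial>lborel) = ennreal c * (\<integral>\<^sup>+x. 1 - expneg (\<sigma> x) \<partial>lborel)"
proof -
  interpret LS: pair_sigma_finite lborel scatter ..
  have "(\<integral>\<^sup>+x. (\<integral>\<^sup>+d. 1 - expneg (\<sigma> (x + d)) \<partial>scatter) \<partial>lborel)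
      = (\<integral>\<^sup>+d. (\<integral>\<^sup>+x. 1 - expneg (\<sigma> (d + x)) \<partial>lborel) \<partial>scatter)"
    by (subst LS.Fubini') (auto simp: add.commute)
  also have "\<dots> = (\<integral>\<^sup>+x. 1 - expneg (\<sigma> x) \<partial>lborel)"
    using nn_integral_lborel_translate[of "\<lambda>x. 1 - expneg (\<sigma> x)"] scatter.emeasure_space_1 by simp
  finally show ?thesis
    by (simp add: cluster_exponent_def nn_integral_cmult)
qed

lemma nn_integral_cluster_exponent_scatter:
  assumes [measurable]: "\<sigma> \<in> borel_measurable borel"
  shows "(\<integral>\<^sup>+d. cluster_exponent \<sigma> (- d) \<partial>scatter)
    = ennreal c * (\<integral>\<^sup>+y. (1 - expneg (\<sigma> y)) * fun_convolution f f y \<partial>lborel)"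
proof -
  let ?w = "\<lambda>y. 1 - expneg (\<sigma> y)"
  have inner: "(\<integral>\<^sup>+d'. ?w (- d + d') \<partial>scatter) = (\<integral>\<^sup>+y. ennreal (f (y + d)) * ?w y \<partial>lborel)" for d
    using nn_integral_lborel_translate[of "\<lambda>y. ennreal (f (y + d)) * ?w y" "- d"]
    by (subst nn_integral_scatter) auto
  have conv: "(\<integral>\<^sup>+d. ennreal (f d) * ennreal (f (y + d)) \<partial>lborel) = fun_convolution f f y" for y
  proof -
    \<comment> \<open>Isotropy makes f even, which turns the correlation of f with itself, the
      density of a difference of two displacements, into the convolution.\<close>
    have "f (- d) = f d" for d by (rule f_eq) simp
    then show ?thesis
      using nn_integral_lborel_reflect[of "\<lambda>d. ennreal (f d) * ennreal (f (y + d))" 0]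
      by (simp add: fun_convolution_def)
  qed
  have "(\<integral>\<^sup>+d. (\<integral>\<^sup>+d'. ?w (- d + d') \<partial>scatter) \<partial>scatter)
      = (\<integral>\<^sup>+d. (\<integral>\<^sup>+y. ?w y * (ennreal (f d) * ennreal (f (y + d))) \<partial>lborel) \<partial>lborel)"
    unfolding inner by (subst nn_integral_scatter) (auto simp: nn_integral_cmult[symmetric] mult_ac)
  also have "\<dots> = (\<integral>\<^sup>+y. (\<integral>\<^sup>+d. ?w y * (ennreal (f d) * ennreal (f (y + d))) \<partial>lborel) \<partial>lborel)"
    by (rule lborel_pair.Fubini') measurable
  also have "\<dots> = (\<integral>\<^sup>+y. ?w y * fun_convolution f f y \<partial>lborel)"
    by (intro nn_integral_cong) (subst nn_integral_cmult, simp_all add: conv)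
  finally show ?thesis
    by (simp add: cluster_exponent_def nn_integral_cmult)
qed

lemma palm_value_ge:
  assumes [measurable]: "\<sigma> \<in> borel_measurable borel"
  defines "J \<equiv> \<integral>\<^sup>+x. 1 - expneg (\<sigma> x) \<partial>lborel"
  shows "expneg (ennreal l * (ennreal c * J)) * expneg (ennreal c * ((SUP y. fun_convolution f f y) * J)) \<le> palm_value \<sigma>"
  unfolding palm_value_def
proof (rule mult_mono)
  have "(\<integral>\<^sup>+x. 1 - expneg (cluster_exponent \<sigma> x) \<partial>lborel) \<le> (\<integral>\<^sup>+x. cluster_exponent \<sigma> x \<partial>lborel)"
    by (intro nn_integral_mono one_minus_expneg_le)
  then show "expneg (ennreal l * (ennreal c * J)) \<le> expneg (ennreal l * (\<integral>\<^sup>+x. 1 - expneg (cluster_exponent \<sigma> x) \<partial>lborel))"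
    by (intro expneg_antimono mult_left_mono) (auto simp: nn_integral_cluster_exponent J_def)
  have "(\<integral>\<^sup>+y. (1 - expneg (\<sigma> y)) * fun_convolution f f y \<partial>lborel)
      \<le> (\<integral>\<^sup>+y. (1 - expneg (\<sigma> y)) * (SUP y. fun_convolution f f y) \<partial>lborel)"
    by (intro nn_integral_mono mult_left_mono SUP_upper) auto
  also have "\<dots> = (SUP y. fun_convolution f f y) * J"
    by (simp add: nn_integral_multc J_def mult.commute)
  finally have "expneg (ennreal c * ((SUP y. fun_convolution f f y) * J)) \<le> expneg (\<integral>\<^sup>+d. cluster_exponent \<sigma> (- d) \<partial>scatter)"
    by (intro expneg_antimono) (auto simp: nn_integral_cluster_exponent_scatter intro!: mult_left_mono)
  also have "\<dots> \<le> (\<integral>\<^sup>+d. expneg (cluster_exponent \<sigma> (- d)) \<partial>scatter)"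
    by (intro expneg_nn_integral_le scatter.prob_space_axioms) measurable
  finally show "expneg (ennreal c * ((SUP y. fun_convolution f f y) * J)) \<le> (\<integral>\<^sup>+d. expneg (cluster_exponent \<sigma> (- d)) \<partial>scatter)" .
qed auto

lemma palm_value_le_1: "palm_value \<sigma> \<le> 1"
proof -
  have "(\<integral>\<^sup>+d. expneg (cluster_exponent \<sigma> (- d)) \<partial>scatter) \<le> 1"
    by (rule nn_integral_expneg_scatter_le)
  then show ?thesis
    unfolding palm_value_def using mult_mono[OF expneg_le_1, of _ 1] by fastforce
qed

end

lemma poisson_success_finite:
  assumes "0 \<le> x"
  shows "poisson_success g T z (ennreal x) = exp (- (x * (\<integral>y. g y / (g z / T + g y) \<partial>lborel)))"
  using assms by (simp add: poisson_success_def)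

theorem lemma5:
  fixes M :: "'w measure" and \<phi> :: "'w \<Rightarrow> plane set"
    and lp c \<mu> T R :: real and f g :: "plane \<Rightarrow> real" and z :: plane
  assumes "prob_space M"
    and "lp > 0" and "c > 0" and "isotropic_density f"
    and "neyman_scott_process M lp c f \<phi>"
    and "path_loss g" and "\<mu> > 0" and "T > 0" and "R > 0" and "norm z = R"
  shows "success_prob M \<phi> \<mu> g T z \<ge>
           poisson_success g T z (ennreal (lp * c)) *
           poisson_success g T z (ennreal c * (SUP y. fun_convolution f f y))"
proof -
  interpret prob_space M by fact
  obtain X K where XK: "stationary_poisson_process M lp X \<and>
        (\<forall>i. K i \<in> measurable M (cluster_law c f)) \<and>
        distr M ((\<Pi>\<^sub>M i\<in>UNIV. borel) \<Otimes>\<^sub>M (\<Pi>\<^sub>M i\<in>UNIV. cluster_law c f))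
            (\<lambda>\<omega>. (\<lambda>i. X i \<omega>, \<lambda>i. K i \<omega>))
          = distr M (\<Pi>\<^sub>M i\<in>UNIV. borel) (\<lambda>\<omega> i. X i \<omega>) \<Otimes>\<^sub>M (\<Pi>\<^sub>M i\<in>UNIV. cluster_law c f) \<and>
        (\<forall>\<omega>\<in>space M. \<phi> \<omega> = (\<Union>i::nat. {X i \<omega> + snd (K i \<omega>) j | j. j < fst (K i \<omega>)}))"
    using assms(5)[unfolded neyman_scott_process_def] by (elim exE)
  note \<phi> = bspec[OF XK[THEN conjunct2, THEN conjunct2, THEN conjunct2]]
  interpret neyman_scott M lp X c f K
    using assms XK by unfold_locales (simp_all only: less_imp_le)
  have z: "z \<noteq> 0" using assms by auto
  have gz: "0 < g z" using path_loss_pos[OF assms(6) z] .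
  have [measurable]: "g \<in> borel_measurable borel" by (rule path_loss_measurable) fact
  have [measurable]: "log_loss T g z \<in> borel_measurable borel" unfolding log_loss_def by measurable
  define J where "J = (\<integral>y. g y / (g z / T + g y) \<partial>lborel)"
  have J: "(\<integral>\<^sup>+x. 1 - expneg (log_loss T g z x) \<partial>lborel) = ennreal J"
    unfolding J_def using assms z by (intro nn_integral_outage)
  have J0: "0 \<le> J"
    unfolding J_def using assms z by (intro integral_nonneg_AE outage_nonneg_AE)
  define F where "F = (SUP y. fun_convolution f f y)"
  have eq: "success_prob M \<phi> \<mu> g T z = enn2real (palm_value (log_loss T g z))"
    using assms gz by (intro success_prob_eq \<phi>) auto
  have "palm_value (log_loss T g z) \<noteq> \<top>"
    using palm_value_le_1[of "log_loss T g z"] by (auto simp: top_unique)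
  \<comment> \<open>Finiteness of the Palm value matters here: \<open>enn2real\<close> is monotone
    only below \<top>.\<close>
  then have ge: "r \<le> success_prob M \<phi> \<mu> g T z" if "ennreal r \<le> palm_value (log_loss T g z)" "0 \<le> r" for r
    unfolding eq using that enn2real_mono[of "ennreal r"] by (simp add: less_top)
  show ?thesis
  proof (cases F)
    case (real r)
    have "expneg (ennreal lp * (ennreal c * ennreal J)) * expneg (ennreal c * (ennreal r * ennreal J))
        = ennreal (exp (- (lp * c * J)) * exp (- (c * r * J)))"
      using assms J0 real by (simp add: mult.assoc flip: ennreal_mult)
    then have "ennreal (exp (- (lp * c * J)) * exp (- (c * r * J))) \<le> palm_value (log_loss T g z)"
      using palm_value_ge[of "log_loss T g z"] real by (simp add: J F_def[symmetric])
    then have "exp (- (lp * c * J)) * exp (- (c * r * J)) \<le> success_prob M \<phi> \<mu> g T z"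
      by (rule ge) simp
    moreover have "ennreal c * F = ennreal (c * r)" using real assms by (simp add: ennreal_mult)
    ultimately show ?thesis
      using assms real unfolding F_def[symmetric]
      by (simp add: poisson_success_finite J_def[symmetric])
  next
    case top
    \<comment> \<open>If the supremum of f * f is infinite then so is its product with c > 0, and
      the second Poisson factor is 0 by convention.\<close>
    then have "poisson_success g T z (ennreal c * F) = 0"
      using assms by (simp add: poisson_success_def ennreal_mult_top)
    then show ?thesis unfolding F_def[symmetric] eq by simp
  qed
qed

end
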